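(* Consider the $GI/M/1/n$ queueing system with fixed interarrival distribution function $A$ and fixed service rate $\mu$ (the same for all $n$), with load $\rho=\lambda/\mu$, and let $p_n$ be its loss probability. (i) If $\rho<1$, then as $n\to\infty$ $$p_n=\frac{(1-\rho)\,[1+\mu\alpha'(\mu-\mu\sigma)]\,\sigma^n}{1-\rho-\rho\,[1+\mu\alpha'(\mu-\mu\sigma)]\,\sigma^n}+o(\sigma^{2n}),$$ where $\alpha'$ is the derivative of $\alpha$ and $\sigma$ is the minimum nonnegative solution of $z=\alpha(\mu-\mu z)$ (which lies in $(0,1)$ in this case). (ii) If $\rho=1$ and $\rho_2<\infty$, then $$\lim_{n\to\infty} n\,p_n=\frac{\rho_2}{2}.$$ (iii) If $\rho>1$, then $$\lim_{n\to\infty}p_n=\frac{\rho-1}{\rho}.$$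
   Context: $GI/M/1/n$ queue: a single-server loss system in which interarrival times are i.i.d. nonnegative random variables with distribution function $A(x)$ having mean $1/\lambda$, $0<\lambda<\infty$; service times are i.i.d. exponential with parameter $\mu>0$, independent of arrivals; the system holds at most $n$ customers (the buffer size $n$ includes the position at the server), and customers arriving when the system is full are lost. Notation: $\alpha(s)=\int_0^\infty e^{-sx}\,dA(x)$; $\rho=\lambda/\mu$; $\rho_m=\mu^m\int_0^\infty x^m\,dA(x)$ for $m=1,2,\dots$ (so $\rho_1=\rho^{-1}$). The loss probability $p_n$ is the stationary probability that an arriving customer finds the system full. It exists for every value of $\rho$ and is given by $$p_n=\frac{1}{\sum_{j=0}^n\pi_j},\qquad \sum_{j=0}^\infty\pi_jz^j=\frac{(1-z)\,\alpha(\mu-\mu z)}{\alpha(\mu-\mu z)-z},\quad |z|<\sigma,$$ where $\sigma$ is the minimum nonnegative solution of $z=\alpha(\mu-\mu z)$; $\sigma\in(0,1)$ if $\lambda<\mu$ and $\sigma=1$ otherwise. *)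

theory Defs
  imports "HOL-Probability.Probability" "HOL-Library.Landau_Symbols"
begin

text \<open>
  Throughout, \<open>A\<close> is the law on the real line of an interarrival time (the measure whose
  distribution function is \<open>A(x)\<close>), \<open>\<mu>\<close> is the service rate, and \<open>n\<close> is the capacity of the
  system, the position at the server included.
\<close>

definition laplace_stieltjes :: "real measure \<Rightarrow> real \<Rightarrow> real" where
  "laplace_stieltjes A s = (LINT x|A. exp (- s * x))"

definition rho_moment :: "real measure \<Rightarrow> real \<Rightarrow> nat \<Rightarrow> real" where
  "rho_moment A \<mu> m = \<mu> ^ m * (LINT x|A. x ^ m)"

definition min_root :: "real measure \<Rightarrow> real \<Rightarrow> real" where
  "min_root A \<mu> = (LEAST z. 0 \<le> z \<and> z = laplace_stieltjes A (\<mu> - \<mu> * z))"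

definition services_law :: "real \<Rightarrow> (nat \<Rightarrow> real) measure" where
  "services_law \<mu> = (\<Pi>\<^sub>M k\<in>(UNIV :: nat set). density lborel (exponential_density \<mu>))"

text \<open>
  If \<open>m\<close> customers are present and \<open>s 0, s 1, \<dots>\<close> are their successive (remaining) service
  times, the \<open>k\<close>-th of them leaves after time \<open>s 0 + \<dots> + s (k - 1)\<close>.
\<close>

definition num_served :: "nat \<Rightarrow> real \<Rightarrow> (nat \<Rightarrow> real) \<Rightarrow> nat" where
  "num_served m x s = card {k \<in> {1..m}. (\<Sum>j<k. s j) \<le> x}"

text \<open>
  The number of customers found by an arrival, when the previous arrival, a time \<open>x\<close> earlier,
  found \<open>i\<close> customers. The previous arrival was lost if \<open>i = n\<close> and was admitted otherwise, so
  that \<open>min (i + 1) n\<close> customers were present just after it.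
\<close>

definition next_found :: "nat \<Rightarrow> nat \<Rightarrow> real \<Rightarrow> (nat \<Rightarrow> real) \<Rightarrow> nat" where
  "next_found n i x s = min (i + 1) n - num_served (min (i + 1) n) x s"

text \<open>
  The numbers of customers found by successive arrivals form a Markov chain on \<open>{0..n}\<close>: the
  remaining service time of a customer in service at an arrival epoch is again exponential with
  parameter \<open>\<mu>\<close> and independent of the past.
\<close>

definition transition_prob :: "real measure \<Rightarrow> real \<Rightarrow> nat \<Rightarrow> nat \<Rightarrow> nat \<Rightarrow> real" where
  "transition_prob A \<mu> n i j =
     measure (A \<Otimes>\<^sub>M services_law \<mu>)
       {(x, s) \<in> space (A \<Otimes>\<^sub>M services_law \<mu>). next_found n i x s = j}"

definition stationary :: "real measure \<Rightarrow> real \<Rightarrow> nat \<Rightarrow> nat pmf \<Rightarrow> bool" where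
  "stationary A \<mu> n q \<longleftrightarrow>
     set_pmf q \<subseteq> {..n} \<and>
     (\<forall>j\<le>n. pmf q j = (\<Sum>i\<le>n. pmf q i * transition_prob A \<mu> n i j))"

definition loss_prob :: "real measure \<Rightarrow> real \<Rightarrow> nat \<Rightarrow> real" where
  "loss_prob A \<mu> n = pmf (THE q. stationary A \<mu> n q) n"

end

theory Submission
  imports Defs "HOL-Real_Asymp.Real_Asymp"
begin

text \<open>
  Let \<open>a\<^sub>k\<close> be the probability of \<open>k\<close> Poisson events of rate \<open>\<mu>\<close> in an interarrival time, so
  that \<open>\<alpha>(\<mu> - \<mu> z) = \<Sum> a\<^sub>k z\<^sup>k\<close>; write \<open>F(z)\<close> for this series. Read backwards from state \<open>n\<close>, the
  stationary equations of the embedded chain are a recursion that does not depend on \<open>n\<close>. Its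
  solution has the generating function \<open>\<pi> = (1 - z) F / (F - z)\<close>, whence \<open>p\<^sub>n = 1 / S\<^sub>n\<close> with the
  partial sums \<open>S\<^sub>n\<close> of its coefficients.

  If \<open>B\<close> has the tails of \<open>a\<close> as coefficients, then \<open>F - z = (1 - z) (1 - B)\<close> and \<open>\<pi> = F / (1 - B)\<close>,
  where \<open>B(1) = 1 / \<rho>\<close>. For \<open>\<rho> > 1\<close> this gives \<open>S\<^sub>n \<longlonglongrightarrow> 1 / (1 - B(1))\<close>. For \<open>\<rho> = 1\<close> the
  coefficients of \<open>1 / (1 - B)\<close> form a renewal sequence and converge to the reciprocal of
  \<open>B'(1) = \<rho>\<^sub>2 / 2\<close>. For \<open>\<rho> < 1\<close> one has \<open>F - z = (\<sigma> - z) (1 - C)\<close> with the generating function \<open>C\<close>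
  of another probability distribution. Since \<open>S = F / ((\<sigma> - z) (1 - C))\<close>, the renewal theorem for
  \<open>C\<close> yields \<open>S\<^sub>n = \<sigma>\<^sup>-\<^sup>n / (1 + \<mu> \<alpha>'(\<mu> - \<mu> \<sigma>)) - \<rho> / (1 - \<rho>) + o(1)\<close>, which is inverted.
\<close>

unbundle fps_syntax
unbundle no vec_syntax

section \<open>Power series and their tails\<close>

lemma fps_one_minus_X_mult_partial_sums:
  "(1 - fps_X) * Abs_fps (\<lambda>n. \<Sum>k\<le>n. f $ k) = (f :: 'a::comm_ring_1 fps)"
proof (rule fps_ext)
  fix n
  show "((1 - fps_X) * Abs_fps (\<lambda>n. \<Sum>k\<le>n. f $ k)) $ n = f $ n"
    by (cases n) (auto simp: left_diff_distrib)
qed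

lemma fps_nth_eq_partial_sum:
  fixes f g :: "'a::idom fps"
  assumes "(1 - fps_X) * g = f"
  shows "g $ n = (\<Sum>k\<le>n. f $ k)"
proof -
  have "(1 - fps_X) * g = (1 - fps_X) * Abs_fps (\<lambda>n. \<Sum>k\<le>n. f $ k)"
    using assms by (simp only: fps_one_minus_X_mult_partial_sums)
  moreover have "(1 - fps_X :: 'a fps) \<noteq> 0"
    by (metis diff_0_right eq_iff_diff_eq_0 fps_X_nth fps_one_nth fps_sub_nth fps_zero_nth zero_neq_one)
  ultimately have "g = Abs_fps (\<lambda>n. \<Sum>k\<le>n. f $ k)"
    by simp
  then show ?thesis by simp
qed

text \<open>
  The divided difference of the power series of \<open>x\<close> at \<open>z\<close>, that is
  \<open>(x(z) - x(X)) / (z - X)\<close>; for \<open>z = 1\<close> its coefficients are the tails of \<open>x\<close>.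
\<close>

definition tail_fps :: "real \<Rightarrow> (nat \<Rightarrow> real) \<Rightarrow> real fps" where
  "tail_fps z x = Abs_fps (\<lambda>i. \<Sum>j. x (Suc i + j) * z ^ j)"

lemma summable_tail:
  fixes z :: real
  assumes "summable (\<lambda>k. x k * z ^ k)"
  shows "summable (\<lambda>j. x (n + j) * z ^ j)"
proof (cases "z = 0")
  case True
  then show ?thesis
    by (intro summable_finite[of "{0}"]) auto
next
  case False
  have "summable (\<lambda>j. x (j + n) * z ^ (j + n))"
    by (rule summable_ignore_initial_segment[OF assms])
  then have "summable (\<lambda>j. (x (j + n) * z ^ (j + n)) * inverse (z ^ n))"
    by (rule summable_mult2)
  then show ?thesis
    using False by (simp add: power_add add.commute mult.assoc)
qed

text \<open>The weighted tails \<open>t n = (\<Sum>j. x (n + j) * z ^ j)\<close> satisfy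
  \<open>t n = x n + z * t (Suc n)\<close>, and \<open>t 0\<close> is the value of the series at
  \<open>z\<close>. Comparing coefficients gives the factorization, by which zeros at
  \<open>1\<close> and at \<open>\<sigma>\<close> are divided out below.\<close>

lemma fps_const_minus_Abs_fps_eq_tail:
  fixes z :: real
  assumes "summable (\<lambda>k. x k * z ^ k)"
  shows "fps_const (\<Sum>k. x k * z ^ k) - Abs_fps x = (fps_const z - fps_X) * tail_fps z x"
proof -
  have split: "(\<Sum>j. x (n + j) * z ^ j) = x n + z * (\<Sum>j. x (Suc n + j) * z ^ j)" for n
  proof -
    have "(\<Sum>j. x (n + j) * z ^ j) = x n + (\<Sum>j. x (n + Suc j) * z ^ Suc j)"
      using suminf_split_head[OF summable_tail[OF assms, of n]] by simp
    also have "(\<lambda>j. x (n + Suc j) * z ^ Suc j) = (\<lambda>j. z * (x (Suc n + j) * z ^ j))"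
      by (auto simp: algebra_simps)
    also have "(\<Sum>j. z * (x (Suc n + j) * z ^ j)) = z * (\<Sum>j. x (Suc n + j) * z ^ j)"
      by (rule suminf_mult[OF summable_tail[OF assms]])
    finally show ?thesis .
  qed
  show ?thesis
  proof (rule fps_ext)
    fix n
    show "(fps_const (\<Sum>k. x k * z ^ k) - Abs_fps x) $ n = ((fps_const z - fps_X) * tail_fps z x) $ n"
      using split[of 0] split[of n]
      by (cases n) (auto simp: left_diff_distrib tail_fps_def simp del: suminf_mult)
  qed
qed

lemma tail_fps_pos:
  assumes "\<And>k. 0 < x k" "0 < z" "summable (\<lambda>k. x k * z ^ k)"
  shows "0 < tail_fps z x $ i"
  unfolding tail_fps_def fps_nth_Abs_fps
  by (intro suminf_pos summable_tail assms mult_pos_pos zero_less_power)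

text \<open>Interchanging the sums, the sum over \<open>i\<close> for fixed \<open>j\<close> is at
  most \<open>suminf x\<close>, which leaves a geometric series in \<open>z\<close>.\<close>

lemma summable_tail_fps:
  assumes x: "\<And>k. 0 \<le> x k" "summable x" and z: "0 \<le> z" "z < 1"
  shows "summable (fps_nth (tail_fps z x))"
proof (rule summableI_nonneg_bounded)
  have s: "summable (\<lambda>k. x k * z ^ k)"
    using z by (intro summable_comparison_test'[OF x(2)])
      (auto simp: x abs_mult intro!: mult_left_le power_le_one)
  show "0 \<le> tail_fps z x $ i" for i
    using x z by (auto simp: tail_fps_def intro!: suminf_nonneg summable_tail[OF s, of "Suc i", simplified])
  fix n
  have "(\<Sum>i<n. tail_fps z x $ i) = (\<Sum>j. \<Sum>i<n. x (Suc i + j) * z ^ j)"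
    unfolding tail_fps_def fps_nth_Abs_fps by (rule suminf_sum[symmetric]) (rule summable_tail[OF s])
  also have "\<dots> \<le> (\<Sum>j. suminf x * z ^ j)"
  proof (rule suminf_le)
    fix j
    have "(\<Sum>i<n. x (Suc i + j)) = sum x ((\<lambda>i. Suc i + j) ` {..<n})"
      by (subst sum.reindex) (auto simp: inj_on_def)
    also have "\<dots> \<le> suminf x"
      using x by (intro sum_le_suminf) auto
    finally show "(\<Sum>i<n. x (Suc i + j) * z ^ j) \<le> suminf x * z ^ j"
      using z by (simp add: sum_distrib_right[symmetric] mult_right_mono)
  qed (use z in \<open>auto intro!: summable_sum summable_mult summable_geometric summable_tail[OF s, of "Suc _", simplified]\<close>)
  finally show "(\<Sum>i<n. tail_fps z x $ i) \<le> (\<Sum>j. suminf x * z ^ j)" .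
qed

section \<open>Bounded coefficients and evaluation inside the unit disc\<close>

lemma convergent_abs_bound:
  fixes x :: "nat \<Rightarrow> real"
  assumes "convergent x"
  obtains M where "\<And>n. \<bar>x n\<bar> \<le> M"
  using convergent_imp_Bseq[OF assms] unfolding Bseq_def real_norm_def by blast

lemma summable_abs_bound:
  fixes x :: "nat \<Rightarrow> real"
  assumes "summable x"
  obtains M where "\<And>n. \<bar>x n\<bar> \<le> M"
  using convergent_abs_bound[OF convergentI[OF summable_LIMSEQ_zero[OF assms]]] by blast

lemma fps_conv_radius_ge_1:
  fixes f :: "real fps"
  assumes "\<And>n. \<bar>f $ n\<bar> \<le> M"
  shows "1 \<le> fps_conv_radius f"
  unfolding fps_conv_radius_def
proof (rule conv_radius_geI_ex')
  fix r :: real assume r: "0 < r" "ereal r < 1"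
  have "summable (\<lambda>n. M * r ^ n)"
    using r by (intro summable_mult summable_geometric) simp
  moreover have "norm (f $ n * r ^ n) \<le> M * r ^ n" for n
    using mult_right_mono[OF assms[of n], of "r ^ n"] r by (simp add: abs_mult)
  ultimately have "summable (\<lambda>n. f $ n * r ^ n)"
    by (rule summable_comparison_test'[of _ 0])
  then show "summable (\<lambda>n. f $ n * of_real r ^ n)" by simp
qed

lemma fps_conv_radius_gt:
  fixes f :: "real fps" and z :: real
  assumes "\<And>n. \<bar>f $ n\<bar> \<le> M" "\<bar>z\<bar> < 1"
  shows "ereal (norm z) < fps_conv_radius f"
proof -
  have "ereal (norm z) < 1"
    using assms(2) by simp
  also have "1 \<le> fps_conv_radius f"
    using assms(1) by (rule fps_conv_radius_ge_1)
  finally show ?thesis .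
qed

text \<open>Bounded coefficients force radius of convergence at least \<open>1\<close>, so a formal
  factorization may be evaluated at every point of the open disc.\<close>

lemma eval_fps_tail:
  fixes f g :: "real fps"
  assumes eq: "fps_const c - f = (fps_const w - fps_X) * g"
    and f: "\<And>n. \<bar>f $ n\<bar> \<le> M" and g: "\<And>n. \<bar>g $ n\<bar> \<le> K" and z: "\<bar>z\<bar> < 1"
  shows "c - eval_fps f z = (w - z) * eval_fps g z"
proof -
  have f': "ereal (norm z) < fps_conv_radius f" and g': "ereal (norm z) < fps_conv_radius g"
    using fps_conv_radius_gt[OF f z] fps_conv_radius_gt[OF g z] .
  have "ereal (norm z) < fps_conv_radius (fps_const w - fps_X)"
    by (rule less_le_trans[OF _ fps_conv_radius_diff]) simp
  then have "eval_fps ((fps_const w - fps_X) * g) z = (w - z) * eval_fps g z"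
    using g' by (simp add: eval_fps_mult eval_fps_diff)
  moreover have "eval_fps (fps_const c - f) z = c - eval_fps f z"
    using f' by (simp add: eval_fps_diff)
  ultimately show ?thesis
    by (simp add: eq)
qed

lemma fps_const_minus_X_neq_0: "fps_const c - fps_X \<noteq> (0 :: real fps)"
proof
  assume "fps_const c - fps_X = (0 :: real fps)"
  then have "(fps_const c - fps_X) $ 1 = (0 :: real fps) $ 1" by simp
  then show False by simp
qed

text \<open>Tannery's theorem: the terms converge for each \<open>j\<close> and are dominated by the
  geometric series \<open>M * z ^ j\<close>.\<close>

lemma tail_fps_tendsto:
  assumes x: "x \<longlonglongrightarrow> L" and z: "0 \<le> z" "z < 1"
  shows "fps_nth (tail_fps z x) \<longlonglongrightarrow> L / (1 - z)"
proof -
  obtain M where M: "\<And>n. \<bar>x n\<bar> \<le> M"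
    using convergent_abs_bound[OF convergentI[OF x]] by blast
  have "(\<lambda>n. \<Sum>j. x (Suc n + j) * z ^ j) \<longlonglongrightarrow> (\<Sum>j. L * z ^ j)"
  proof (rule conjunct2[OF conjunct2[OF tannerys_theorem]])
    fix j
    have "(\<lambda>n. x (n + Suc j)) \<longlonglongrightarrow> L"
      using x by (rule LIMSEQ_ignore_initial_segment)
    then have "(\<lambda>n. x (Suc n + j)) \<longlonglongrightarrow> L"
      by simp
    then show "(\<lambda>n. x (Suc n + j) * z ^ j) \<longlonglongrightarrow> L * z ^ j"
      by (intro tendsto_intros)
  next
    have "norm (x (Suc n + j) * z ^ j) \<le> M * z ^ j" for n j
      using mult_right_mono[OF M[of "Suc n + j"], of "z ^ j"] z by (simp add: abs_mult)
    then show "\<forall>\<^sub>F (j, n) in at_top \<times>\<^sub>F sequentially. norm (x (Suc n + j) * z ^ j) \<le> M * z ^ j"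
      by (intro always_eventually) auto
  qed (use z in \<open>auto intro!: summable_mult summable_geometric\<close>)
  moreover have "(\<Sum>j. L * z ^ j) = L / (1 - z)"
    using z by (subst suminf_mult) (auto intro: summable_geometric simp: suminf_geometric)
  moreover have "fps_nth (tail_fps z x) = (\<lambda>n. \<Sum>j. x (Suc n + j) * z ^ j)"
    by (simp add: tail_fps_def fun_eq_iff)
  ultimately show ?thesis
    by simp
qed

lemma fps_nth_div_const_minus_X:
  fixes f :: "real fps"
  assumes "(fps_const s - fps_X) * f = fps_const c" "s \<noteq> 0"
  shows "f $ n = c / s ^ Suc n"
proof (induction n)
  case 0
  have "((fps_const s - fps_X) * f) $ 0 = fps_const c $ 0"
    by (simp only: assms)
  then show ?case
    using assms(2) by (simp add: field_simps)
next
  case (Suc n)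
  have "((fps_const s - fps_X) * f) $ Suc n = fps_const c $ Suc n"
    by (simp only: assms)
  then have "s * f $ Suc n = f $ n"
    by (simp add: left_diff_distrib)
  then show ?case
    using assms(2) Suc by (simp add: field_simps)
qed

section \<open>The reciprocal of \<open>1 - Abs_fps c\<close>\<close>

lemma fps_one_minus_inverse:
  fixes c :: "nat \<Rightarrow> real"
  assumes "c 0 < 1"
  shows "(1 - Abs_fps c) * inverse (1 - Abs_fps c) = 1"
  using assms by (intro inverse_mult_eq_1') simp

lemma fps_inverse_one_minus_rec:
  fixes c :: "nat \<Rightarrow> real"
  assumes "c 0 < 1"
  defines "v \<equiv> fps_nth (inverse (1 - Abs_fps c))"
  shows "v n = (if n = 0 then 1 else 0) + (\<Sum>i\<le>n. c i * v (n - i))"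
proof -
  have "((1 - Abs_fps c) * inverse (1 - Abs_fps c)) $ n = (1 :: real fps) $ n"
    using fps_one_minus_inverse[of c] assms(1) by simp
  then show ?thesis
    by (simp add: left_diff_distrib fps_mult_nth atLeast0AtMost v_def)
qed

lemma fps_inverse_one_minus_nonneg:
  fixes c :: "nat \<Rightarrow> real"
  assumes c: "\<And>i. 0 \<le> c i" "c 0 < 1"
  shows "0 \<le> inverse (1 - Abs_fps c) $ n"
proof (induction n rule: less_induct)
  case (less n)
  let ?v = "fps_nth (inverse (1 - Abs_fps c))"
  \<comment> \<open>The summand \<open>i = 0\<close> contains \<open>?v n\<close> itself; moved to
    the other side it leaves the positive factor \<open>1 - c 0\<close>, and the other summands are
    covered by the induction hypothesis.\<close>
  have "(\<Sum>i\<le>n. c i * ?v (n - i)) = c 0 * ?v n + (\<Sum>i\<in>{..n} - {0}. c i * ?v (n - i))"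
    by (subst sum.remove[of _ 0]) auto
  then have "(1 - c 0) * ?v n = (if n = 0 then 1 else 0) + (\<Sum>i\<in>{..n} - {0}. c i * ?v (n - i))"
    using fps_inverse_one_minus_rec[of c n, OF c(2)] by (simp add: left_diff_distrib)
  also have "0 \<le> \<dots>"
    using less c(1) by (intro add_nonneg_nonneg sum_nonneg mult_nonneg_nonneg) auto
  finally show ?case
    using c(2) by (simp add: zero_le_mult_iff)
qed

section \<open>The renewal theorem\<close>

lemma tendsto_convolution_subseq:
  fixes x y :: "nat \<Rightarrow> real"
  assumes x: "summable (\<lambda>i. \<bar>x i\<bar>)" and y: "\<And>n. \<bar>y n\<bar> \<le> M" and r: "strict_mono r"
    and lim: "\<And>i. (\<lambda>k. y (r k - i)) \<longlonglongrightarrow> L"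
  shows "(\<lambda>k. \<Sum>i\<le>r k. x i * y (r k - i)) \<longlonglongrightarrow> suminf x * L"
proof -
  \<comment> \<open>Each convolution becomes an infinite series with the terms beyond
    \<open>r k\<close> set to \<open>0\<close>, so that Tannery's theorem applies with the majorant
    \<open>\<bar>x i\<bar> * M\<close>.\<close>
  define a where "a i k = (if i \<le> r k then x i * y (r k - i) else 0)" for i k
  have "(\<lambda>k. \<Sum>i. a i k) \<longlonglongrightarrow> (\<Sum>i. x i * L)"
  proof (rule conjunct2[OF conjunct2[OF tannerys_theorem]])
    fix i
    have ev: "\<forall>\<^sub>F k in sequentially. i \<le> r k"
      using filterlim_subseq[OF r] by (simp add: filterlim_at_top)
    have "(\<lambda>k. x i * y (r k - i)) \<longlonglongrightarrow> x i * L"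
      by (intro tendsto_intros lim)
    then show "(\<lambda>k. a i k) \<longlonglongrightarrow> x i * L"
      by (rule Lim_transform_eventually) (use ev in eventually_elim, simp add: a_def)
  next
    have "norm (a i k) \<le> \<bar>x i\<bar> * M" for i k
      using y[of 0] y[of "r k - i"] by (auto simp: a_def abs_mult intro!: mult_left_mono)
    then show "\<forall>\<^sub>F (i, k) in at_top \<times>\<^sub>F sequentially. norm (a i k) \<le> \<bar>x i\<bar> * M"
      by (intro always_eventually) auto
  qed (auto intro: summable_mult2 x)
  moreover have "(\<Sum>i. a i k) = (\<Sum>i\<le>r k. x i * y (r k - i))" for k
    by (subst suminf_finite[of "{..r k}"]) (auto simp: a_def)
  moreover have "(\<Sum>i. x i * L) = suminf x * L"
    by (rule suminf_mult2[symmetric]) (rule summable_rabs_cancel[OF x])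
  ultimately show ?thesis by simp
qed

lemma bounded_obtain_limsup:
  fixes y :: "nat \<Rightarrow> real"
  assumes "\<And>n. \<bar>y n\<bar> \<le> M"
  obtains L r where "strict_mono r" "(\<lambda>k. y (r k)) \<longlonglongrightarrow> L"
    "\<And>e. 0 < e \<Longrightarrow> \<forall>\<^sub>F n in sequentially. y n < L + e"
proof -
  define l where "l = limsup (\<lambda>n. ereal (y n))"
  \<comment> \<open>Limits superior exist unconditionally in \<open>ereal\<close>; the bound
    \<open>M\<close> then brings the value back to a real \<open>L\<close>.\<close>
  obtain r where r: "strict_mono r" "(\<lambda>k. ereal (y (r k))) \<longlonglongrightarrow> l"
    using limsup_subseq_lim[of "\<lambda>n. ereal (y n)"] by (auto simp: l_def o_def)
  have bd: "ereal (y n) \<le> ereal M" "ereal (- M) \<le> ereal (y n)" for n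
    using abs_le_D1[OF assms[of n]] abs_le_D2[OF assms[of n]] by simp_all
  have "l \<le> ereal M"
    unfolding l_def by (rule Limsup_bounded) (simp only: bd eventually_True)
  moreover have "ereal (- M) \<le> l"
    by (rule LIMSEQ_le_const[OF r(2)]) (blast intro: bd)
  ultimately obtain L where L: "l = ereal L"
    by (cases l) auto
  show ?thesis
  proof
    show "(\<lambda>k. y (r k)) \<longlonglongrightarrow> L" using r(2) L by simp
    show "\<forall>\<^sub>F n in sequentially. y n < L + e" if "0 < e" for e
      using Limsup_lessD[of sequentially "\<lambda>n. ereal (y n)" "ereal (L + e)"] that L
      by (simp add: l_def)
  qed (fact r)
qed

text \<open>
  Along a subsequence realising the limit superior \<open>L\<close>, the value \<open>y n\<close> is nearly an average of the
  earlier values, none of which exceeds \<open>L\<close> by much and each of which has positive weight; hence all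
  of them are close to \<open>L\<close>.
\<close>

lemma renewal_extremal_subseq:
  fixes c y :: "nat \<Rightarrow> real"
  assumes c: "\<And>i. 0 < c i" "c sums 1" and y: "\<And>n. \<bar>y n\<bar> \<le> M"
    and rec: "\<And>n. 0 < n \<Longrightarrow> y n = (\<Sum>i\<le>n. c i * y (n - i))"
    and r: "strict_mono r" and lim: "(\<lambda>k. y (r k)) \<longlonglongrightarrow> L"
    and sup: "\<And>e. 0 < e \<Longrightarrow> \<forall>\<^sub>F n in sequentially. y n < L + e"
  shows "(\<lambda>k. y (r k - j)) \<longlonglongrightarrow> L"
proof (rule tendstoI)
  fix e :: real assume "0 < e"
  \<comment> \<open>The slack \<open>d\<close> is small enough that a weighted gap
    \<open>c j * D (n - j)\<close> below \<open>2 * d\<close> forces the gap itself below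
    \<open>e\<close>.\<close>
  define d where "d = min (e / 2) (c j * e / 4)"
  have d: "0 < d" "d < e" "2 * d \<le> c j * e / 2"
    using \<open>0 < e\<close> c by (auto simp: d_def min_def)
  obtain N where N: "\<And>n. N \<le> n \<Longrightarrow> y n < L + d"
    using sup[OF d(1)] by (auto simp: eventually_sequentially)
  \<comment> \<open>\<open>D\<close> is the gap below \<open>L + d\<close>. It is nonnegative only
    from \<open>N\<close> on; adding \<open>K\<close> makes it nonnegative at every index.\<close>
  define D where "D n = L + d - y n" for n
  define K where "K = M + \<bar>L\<bar> + d"
  define s where "s n = (\<Sum>i\<le>n. c i)" for n
  have K: "0 \<le> D n + K" for n
    using y[of n] d(1) by (auto simp: K_def D_def)
  have K0: "0 \<le> K" using y[of 0] d(1) by (auto simp: K_def)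
  have s: "s \<longlonglongrightarrow> 1"
    using c(2) by (simp add: s_def[abs_def] sums_def_le)
  \<comment> \<open>The summand \<open>i = j\<close> is bounded by the whole weighted sum of
    corrected gaps. The correction \<open>K\<close> occurs only for \<open>i > n - N\<close>, with
    total weight \<open>s n - s (n - N)\<close>, which vanishes in the limit; along \<open>r\<close>
    the right-hand side tends to \<open>d\<close>.\<close>
  have key: "c j * D (n - j) \<le> (L + d) * s n - y n + K * (s n - s (n - N))"
    if n: "0 < n" "N \<le> n" "j \<le> n" for n
  proof -
    have "c j * D (n - j) \<le> c j * (D (n - j) + (if n - N < j then K else 0))"
      using K0 c(1)[of j] by (auto intro!: mult_left_mono)
    also have "\<dots> \<le> (\<Sum>i\<le>n. c i * (D (n - i) + (if n - N < i then K else 0)))"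
    proof (rule member_le_sum)
      fix i assume "i \<in> {..n} - {j}"
      have "N \<le> n - i" if "\<not> n - N < i"
        using that n by arith
      then have "\<not> n - N < i \<Longrightarrow> 0 \<le> D (n - i)"
        using N[of "n - i"] by (fastforce simp: D_def)
      then show "0 \<le> c i * (D (n - i) + (if n - N < i then K else 0))"
        using K c(1)[of i] by (auto intro!: mult_nonneg_nonneg)
    qed (use n in auto)
    also have "\<dots> = (\<Sum>i\<le>n. c i * (L + d)) - (\<Sum>i\<le>n. c i * y (n - i))
        + (\<Sum>i\<le>n. if n - N < i then c i * K else 0)"
      unfolding sum_subtractf[symmetric] sum.distrib[symmetric]
      by (intro sum.cong) (auto simp: D_def algebra_simps)
    also have "(\<Sum>i\<le>n. if n - N < i then c i * K else 0) = (\<Sum>i\<in>{..n} - {..n - N}. c i * K)"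
      by (rule sum.mono_neutral_cong_right) auto
    also have "\<dots> = K * (s n - s (n - N))"
      by (subst sum_diff) (auto simp: s_def sum_distrib_left right_diff_distrib mult.commute)
    also have "(\<Sum>i\<le>n. c i * (L + d)) = (L + d) * s n"
      by (simp add: s_def sum_distrib_left mult.commute)
    also have "(\<Sum>i\<le>n. c i * y (n - i)) = y n"
      using rec n by simp
    finally show ?thesis .
  qed
  have rtop: "filterlim r sequentially sequentially"
    by (rule filterlim_subseq[OF r])
  have "(\<lambda>n. s (n - N)) \<longlonglongrightarrow> 1"
    using s by (rule_tac k = N in LIMSEQ_offset) simp
  then have "(\<lambda>k. (L + d) * s (r k) - y (r k) + K * (s (r k) - s (r k - N))) \<longlonglongrightarrow> (L + d) * 1 - L + K * (1 - 1)"
    by (intro tendsto_intros lim filterlim_compose[OF s rtop] filterlim_compose[OF _ rtop])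
  then have "\<forall>\<^sub>F k in sequentially. (L + d) * s (r k) - y (r k) + K * (s (r k) - s (r k - N)) < 2 * d"
    using d by (intro order_tendstoD) auto
  moreover have "\<forall>\<^sub>F k in sequentially. N + j + 1 \<le> r k"
    using rtop by (simp add: filterlim_at_top)
  ultimately show "\<forall>\<^sub>F k in sequentially. dist (y (r k - j)) L < e"
  proof eventually_elim
    case (elim k)
    have "c j * D (r k - j) < c j * e"
    proof -
      have "c j * D (r k - j) < 2 * d"
        using key[of "r k"] elim by linarith
      also have "\<dots> < c j * e"
        using d(3) mult_pos_pos[OF c(1)[of j] \<open>0 < e\<close>] by linarith
      finally show ?thesis .
    qed
    then have "D (r k - j) < e"
      using c(1)[of j] by simp
    moreover have "y (r k - j) < L + d"
      using elim by (intro N) arith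
    ultimately show ?case
      using d(1,2) unfolding D_def dist_real_def by linarith
  qed
qed

text \<open>The coefficients of \<open>R\<close> are the tails of \<open>c\<close>, so their sum is
  the mean-type constant of renewal theory. Positivity of all \<open>c i\<close> takes the place of
  aperiodicity. Any subsequential limit that realises an extreme value of \<open>v\<close> is shared
  by all shifts of the subsequence, and the identity \<open>R * v = 1 / (1 - X)\<close> then
  determines it.\<close>

theorem renewal_theorem:
  fixes c :: "nat \<Rightarrow> real" and R :: "real fps"
  assumes c: "\<And>i. 0 < c i" and R: "1 - Abs_fps c = (1 - fps_X) * R" "summable (fps_nth R)"
  shows "fps_nth (inverse (1 - Abs_fps c)) \<longlonglongrightarrow> 1 / (\<Sum>i. R $ i)"
proof -
  define v where "v = fps_nth (inverse (1 - Abs_fps c))"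
  define m where "m = (\<Sum>i. R $ i)"
  have R_nth: "R $ n = 1 - (\<Sum>k\<le>n. c k)" for n
  proof -
    have "R $ n = (\<Sum>k\<le>n. (1 - Abs_fps c) $ k)"
      by (rule fps_nth_eq_partial_sum) (simp add: R)
    also have "\<dots> = 1 - (\<Sum>k\<le>n. c k)"
      by (simp add: sum_subtractf)
    finally show ?thesis .
  qed
  have "(\<lambda>n. 1 - R $ n) \<longlonglongrightarrow> 1 - 0"
    by (intro tendsto_intros summable_LIMSEQ_zero R)
  then have c1: "c sums 1"
    by (simp add: R_nth sums_def_le)
  have R_pos: "0 < R $ n" for n
  proof -
    have "(\<Sum>k\<le>n. c k) < (\<Sum>k\<le>Suc n. c k)"
      using c by simp
    also have "\<dots> \<le> 1"
      using c c1 sum_le_suminf[of c "{..Suc n}"] by (auto simp: sums_iff less_imp_le)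
    finally show ?thesis by (simp add: R_nth)
  qed
  have c0: "0 < 1 - c 0"
    using R_pos[of 0] by (simp add: R_nth)
  have inv: "(1 - Abs_fps c) * Abs_fps v = 1"
    unfolding v_def using c0 by (simp add: fps_one_minus_inverse fps_nth_inverse)
  have rec: "v n = (if n = 0 then 1 else 0) + (\<Sum>i\<le>n. c i * v (n - i))" for n
    unfolding v_def using c0 by (intro fps_inverse_one_minus_rec) simp
  \<comment> \<open>Cancelling \<open>1 - X\<close> in \<open>(1 - X) * R * v = 1\<close> leaves a
    convolution that is constantly \<open>1\<close>. Its summand \<open>i = 0\<close> bounds
    \<open>v\<close>, and its limit along a subsequence identifies the limit of
    \<open>v\<close>.\<close>
  have Rv: "(\<Sum>i\<le>n. R $ i * v (n - i)) = 1" for n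
  proof -
    have "(1 - fps_X) * (R * Abs_fps v) = 1"
      using inv by (simp add: R mult.assoc)
    then have "(R * Abs_fps v) $ n = (\<Sum>k\<le>n. (1 :: real fps) $ k)"
      by (rule fps_nth_eq_partial_sum)
    then show ?thesis
      by (simp add: fps_mult_nth atLeast0AtMost sum.delta)
  qed
  have v0: "0 \<le> v n" for n
    unfolding v_def using c c0 by (intro fps_inverse_one_minus_nonneg) (auto intro: less_imp_le)
  define M where "M = 1 / R $ 0"
  have vM: "\<bar>v n\<bar> \<le> M" for n
  proof -
    have "R $ 0 * v (n - 0) \<le> (\<Sum>i\<le>n. R $ i * v (n - i))"
      using R_pos v0 by (intro member_le_sum) (auto simp: less_imp_le)
    then show ?thesis
      using R_pos[of 0] v0[of n] by (simp add: Rv M_def field_simps)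
  qed
  have m: "0 < m"
    unfolding m_def using R(2) R_pos by (rule suminf_pos)
  \<comment> \<open>The sign \<open>s = 1\<close> treats the limit superior and
    \<open>s = -1\<close> the limit inferior.\<close>
  have extremal: "\<forall>\<^sub>F n in sequentially. s * v n < s / m + e"
    if s: "\<bar>s\<bar> = 1" and e: "0 < e" for s e
  proof -
    have sM: "\<bar>s * v n\<bar> \<le> M" for n
      using vM[of n] s by (simp add: abs_mult)
    obtain L r where r: "strict_mono r" and lim: "(\<lambda>k. s * v (r k)) \<longlonglongrightarrow> L"
      and sup: "\<And>e. 0 < e \<Longrightarrow> \<forall>\<^sub>F n in sequentially. s * v n < L + e"
      using bounded_obtain_limsup[of "\<lambda>n. s * v n", OF sM] by blast
    have "(\<lambda>k. s * v (r k - j)) \<longlonglongrightarrow> L" for j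
    proof (rule renewal_extremal_subseq[of c "\<lambda>n. s * v n", OF c c1 sM _ r lim sup])
      fix n :: nat assume "0 < n"
      then have "s * v n = s * (\<Sum>i\<le>n. c i * v (n - i))"
        using rec[of n] by simp
      then show "s * v n = (\<Sum>i\<le>n. c i * (s * v (n - i)))"
        by (simp add: sum_distrib_left mult.left_commute)
    qed
    then have "(\<lambda>k. \<Sum>i\<le>r k. R $ i * (s * v (r k - i))) \<longlonglongrightarrow> m * L"
      unfolding m_def using R R_pos
      by (intro tendsto_convolution_subseq[OF _ sM r]) (simp_all add: less_imp_le abs_of_pos)
    moreover have "(\<Sum>i\<le>n. R $ i * (s * v (n - i))) = s * (\<Sum>i\<le>n. R $ i * v (n - i))" for n
      by (simp add: sum_distrib_left mult.left_commute)
    ultimately have "(\<lambda>k. s) \<longlonglongrightarrow> m * L"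
      by (simp add: Rv)
    then have "L = s / m"
      using m LIMSEQ_unique[OF tendsto_const, of s "m * L"] by (simp add: field_simps)
    then show ?thesis
      using sup[OF e] by simp
  qed
  have "v \<longlonglongrightarrow> 1 / m"
  proof (rule tendstoI)
    fix e :: real assume "0 < e"
    have "\<forall>\<^sub>F n in sequentially. v n < 1 / m + e"
      "\<forall>\<^sub>F n in sequentially. - v n < - 1 / m + e"
      using extremal[of 1, OF _ \<open>0 < e\<close>] extremal[of "-1", OF _ \<open>0 < e\<close>] by simp_all
    then show "\<forall>\<^sub>F n in sequentially. dist (v n) (1 / m) < e"
      by eventually_elim (auto simp: dist_real_def abs_less_iff)
  qed
  then show ?thesis
    unfolding v_def m_def .
qed

section \<open>Convolution, Cesaro and Abel limits\<close>

lemma tendsto_convolution: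
  fixes x y :: "nat \<Rightarrow> real"
  assumes x: "summable (\<lambda>i. \<bar>x i\<bar>)" and y: "y \<longlonglongrightarrow> L"
  shows "(\<lambda>n. \<Sum>i\<le>n. x i * y (n - i)) \<longlonglongrightarrow> suminf x * L"
proof -
  obtain M where "\<And>n. \<bar>y n\<bar> \<le> M"
    using convergent_abs_bound[OF convergentI[OF y]] by blast
  moreover have "(\<lambda>n. y (n - i)) \<longlonglongrightarrow> L" for i
    using y by (rule_tac k = i in LIMSEQ_offset) simp
  ultimately show ?thesis
    using tendsto_convolution_subseq[OF x, of y M "\<lambda>k. k" L] by (simp add: strict_mono_def)
qed

lemma tendsto_cesaro:
  fixes x :: "nat \<Rightarrow> real"
  assumes "x \<longlonglongrightarrow> L"
  shows "(\<lambda>n. (\<Sum>k\<le>n. x k) / real n) \<longlonglongrightarrow> L"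
proof (rule tendstoI)
  fix e :: real assume e: "0 < e"
  obtain N where N: "\<And>n. N \<le> n \<Longrightarrow> \<bar>x n - L\<bar> < e / 2"
    using LIMSEQ_D[OF assms, of "e / 2"] e by auto
  \<comment> \<open>The sum has \<open>n + 1\<close> terms but the divisor is \<open>n\<close>; the
    surplus \<open>\<bar>L\<bar>\<close> joins the early deviations in a constant that division by
    \<open>n\<close> makes negligible.\<close>
  define K where "K = (\<Sum>k\<le>N. \<bar>x k - L\<bar>) + \<bar>L\<bar>"
  have "(\<lambda>n. K / real n) \<longlonglongrightarrow> 0"
    by (rule lim_const_over_n)
  then have "\<forall>\<^sub>F n in sequentially. K / real n < e / 2"
    using e by (intro order_tendstoD) auto
  moreover have "\<forall>\<^sub>F n in sequentially. N + 1 \<le> n"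
    by (rule eventually_ge_at_top)
  ultimately show "\<forall>\<^sub>F n in sequentially. dist ((\<Sum>k\<le>n. x k) / real n) L < e"
  proof eventually_elim
    case (elim n)
    have "\<bar>(\<Sum>k\<le>n. x k) - real n * L\<bar> = \<bar>(\<Sum>k\<le>n. x k - L) + L\<bar>"
      by (simp add: sum_subtractf algebra_simps)
    also have "\<dots> \<le> (\<Sum>k\<le>n. \<bar>x k - L\<bar>) + \<bar>L\<bar>"
      using sum_abs[of "\<lambda>k. x k - L" "{..n}"] by linarith
    also have "(\<Sum>k\<le>n. \<bar>x k - L\<bar>) = (\<Sum>k\<in>{..N} \<union> {Suc N..n}. \<bar>x k - L\<bar>)"
      using elim by (intro sum.cong) auto
    also have "\<dots> = (\<Sum>k\<le>N. \<bar>x k - L\<bar>) + (\<Sum>k=Suc N..n. \<bar>x k - L\<bar>)"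
      by (rule sum.union_disjoint) auto
    also have "(\<Sum>k=Suc N..n. \<bar>x k - L\<bar>) \<le> real (card {Suc N..n}) * (e / 2)"
      using N by (intro sum_bounded_above) (simp add: less_imp_le)
    also have "\<dots> \<le> real n * (e / 2)"
      using e by (intro mult_right_mono) auto
    finally have "\<bar>(\<Sum>k\<le>n. x k) - real n * L\<bar> \<le> K + real n * (e / 2)"
      by (simp add: K_def)
    moreover have "K < real n * (e / 2)"
      using elim by (simp add: field_simps)
    ultimately have "\<bar>(\<Sum>k\<le>n. x k) - real n * L\<bar> < real n * e"
      by (simp add: field_simps)
    moreover have "(\<Sum>k\<le>n. x k) / real n - L = ((\<Sum>k\<le>n. x k) - real n * L) / real n"
      using elim by (simp add: field_simps)
    ultimately show ?case
      using elim by (simp add: dist_real_def abs_divide field_simps)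
  qed
qed

text \<open>A converse of Abel's theorem for nonnegative coefficients. A finite partial sum is
  continuous in \<open>z\<close> and lies below \<open>g n\<close>, hence is at most
  \<open>l\<close>; conversely \<open>g n \<le> suminf x\<close> term by term.\<close>

lemma nonneg_power_series_limit_sums:
  fixes x z :: "nat \<Rightarrow> real"
  assumes x: "\<And>k. 0 \<le> x k" and z: "\<And>n. 0 < z n" "\<And>n. z n < 1" "z \<longlonglongrightarrow> 1"
    and s: "\<And>n. (\<lambda>k. x k * z n ^ k) sums g n" and lim: "g \<longlonglongrightarrow> l"
  shows "x sums l"
proof -
  have part: "(\<Sum>k<n. x k) \<le> l" for n
  proof (rule LIMSEQ_le[OF _ lim])
    have "(\<lambda>i. \<Sum>k<n. x k * z i ^ k) \<longlonglongrightarrow> (\<Sum>k<n. x k * 1 ^ k)"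
      by (intro tendsto_intros z)
    then show "(\<lambda>i. \<Sum>k<n. x k * z i ^ k) \<longlonglongrightarrow> (\<Sum>k<n. x k)"
      by simp
    have "(\<Sum>k<n. x k * z i ^ k) \<le> g i" for i
      using s[of i] x z(1)[of i] sum_le_suminf[of "\<lambda>k. x k * z i ^ k" "{..<n}"]
      by (simp add: sums_iff less_imp_le)
    then show "\<exists>N. \<forall>i\<ge>N. (\<Sum>k<n. x k * z i ^ k) \<le> g i"
      by blast
  qed
  have sx: "summable x"
    using x part by (rule summableI_nonneg_bounded)
  have "g n \<le> suminf x" for n
  proof -
    have "x k * z n ^ k \<le> x k" for k
      using x z(1,2)[of n] by (intro mult_left_le power_le_one) (auto intro: less_imp_le)
    then show ?thesis
      using s[of n] sx suminf_le[of "\<lambda>k. x k * z n ^ k" x] by (simp add: sums_iff)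
  qed
  then have "l \<le> suminf x"
    using LIMSEQ_le_const2[OF lim] by blast
  moreover have "suminf x \<le> l"
    using sx part by (rule suminf_le_const)
  ultimately show ?thesis
    using sx by (simp add: sums_iff)
qed

section \<open>Transition probabilities\<close>

definition poisson_mass :: "real \<Rightarrow> nat \<Rightarrow> real" where
  "poisson_mass t k = exp (- t) * t ^ k / fact k"

definition poisson_mix :: "real measure \<Rightarrow> real \<Rightarrow> nat \<Rightarrow> real" where
  "poisson_mix A \<mu> k = (LINT x|A. poisson_mass (\<mu> * x) k)"

lemma borel_measurable_poisson_mass [measurable]:
  assumes [measurable]: "f \<in> borel_measurable M"
  shows "(\<lambda>x. poisson_mass (f x) k) \<in> borel_measurable M"
  unfolding poisson_mass_def by measurable

lemma poisson_mass_nonneg: "0 \<le> t \<Longrightarrow> 0 \<le> poisson_mass t k"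
  by (simp add: poisson_mass_def)

lemma poisson_mass_powser_sums:
  "(\<lambda>k. poisson_mass t k * z ^ k) sums exp (- t * (1 - z))"
proof -
  have "(\<lambda>k. exp (- t) * ((t * z) ^ k /\<^sub>R fact k)) sums (exp (- t) * exp (t * z))"
    by (intro sums_mult exp_converges)
  moreover have "exp (- t) * exp (t * z) = exp (- t * (1 - z))"
    by (simp add: exp_add[symmetric] algebra_simps)
  ultimately show ?thesis
    by (simp add: poisson_mass_def power_mult_distrib field_simps)
qed

lemma sum_poisson_mass_le_1:
  assumes "0 \<le> t" "finite K"
  shows "(\<Sum>k\<in>K. poisson_mass t k) \<le> 1"
  using poisson_mass_powser_sums[of t 1] poisson_mass_nonneg[OF assms(1)] assms(2)
    sum_le_suminf[of "poisson_mass t" K] by (simp add: sums_iff)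

lemma poisson_mass_le_1: "0 \<le> t \<Longrightarrow> poisson_mass t k \<le> 1"
  using sum_poisson_mass_le_1[of t "{k}"] by simp

text \<open>The departure times \<open>\<Sum>j<k. s j\<close> are nondecreasing in \<open>k\<close>,
  so the customers gone by time \<open>x\<close> form an initial segment of \<open>{1..m}\<close>;
  \<open>0 \<le> x\<close> settles \<open>k = 0\<close>.\<close>

lemma num_served_ge_iff:
  assumes s: "\<And>j. 0 \<le> s j" and x: "0 \<le> x" and k: "k \<le> m"
  shows "k \<le> num_served m x s \<longleftrightarrow> (\<Sum>j<k. s j) \<le> x"
proof -
  define P where "P k = (\<Sum>j<k. s j)" for k
  define T where "T = {k \<in> {1..m}. P k \<le> x}"
  have mono: "P i \<le> P j" if "i \<le> j" for i j
    unfolding P_def using s that by (intro sum_mono2) auto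
  have fin: "finite T" by (simp add: T_def)
  have "k \<le> card T \<longleftrightarrow> P k \<le> x"
  proof
    assume "P k \<le> x"
    have "P i \<le> x" if "i \<le> k" for i
      using mono[OF that] \<open>P k \<le> x\<close> by linarith
    then have "{1..k} \<subseteq> T"
      using k by (auto simp: T_def)
    then show "k \<le> card T"
      using card_mono[OF fin, of "{1..k}"] by simp
  next
    assume le: "k \<le> card T"
    show "P k \<le> x"
    proof (rule ccontr)
      assume "\<not> P k \<le> x"
      have "i < k" if "P i \<le> x" for i
        using mono[of k i] that \<open>\<not> P k \<le> x\<close> by (cases "i < k") auto
      then have "T \<subseteq> {1..<k}"
        by (auto simp: T_def)
      moreover have "k \<noteq> 0"
        using \<open>\<not> P k \<le> x\<close> x by (cases "k = 0") (auto simp: P_def)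
      ultimately have "card T \<le> card {1..<k}"
        by (intro card_mono) auto
      then show False
        using le \<open>k \<noteq> 0\<close> by simp
    qed
  qed
  then show ?thesis
    by (simp add: num_served_def T_def P_def)
qed

lemma num_served_le: "num_served m x s \<le> m"
proof -
  have "{k \<in> {1..m}. (\<Sum>j<k. s j) \<le> x} \<subseteq> {1..m}" by auto
  from card_mono[OF _ this] show ?thesis by (simp add: num_served_def)
qed

lemma exponential_nonneg_AE: "AE t in density lborel (exponential_density l). 0 \<le> t"
  by (auto simp: AE_density exponential_density_def)

section \<open>Independent exponential service times\<close>

locale service_times =
  fixes \<mu> :: real
  assumes rate_pos: "0 < \<mu>"
begin

sublocale prob_space "services_law \<mu>"
  unfolding services_law_def
  by (intro prob_space_PiM prob_space_exponential_density rate_pos)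

lemma sets_services_law [measurable_cong]:
  "sets (services_law \<mu>) = sets (\<Pi>\<^sub>M k\<in>UNIV. borel)"
  unfolding services_law_def by (intro sets_PiM_cong) auto

lemma space_services_law [simp]: "space (services_law \<mu>) = UNIV"
  by (simp add: services_law_def space_PiM)

lemma borel_measurable_service: "(\<lambda>s. s j) \<in> borel_measurable (services_law \<mu>)"
  by measurable

lemma distr_service: "distr (services_law \<mu>) borel (\<lambda>s. s j) = density lborel (exponential_density \<mu>)"
proof -
  have "distr (services_law \<mu>) borel (\<lambda>s. s j)
      = distr (services_law \<mu>) (density lborel (exponential_density \<mu>)) (\<lambda>s. s j)"
    by (intro distr_cong) auto
  also have "\<dots> = density lborel (exponential_density \<mu>)"
    unfolding services_law_def
    by (intro distr_PiM_component prob_space_exponential_density rate_pos) auto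
  finally show ?thesis .
qed

lemma distributed_service:
  "distributed (services_law \<mu>) lborel (\<lambda>s. s j) (exponential_density \<mu>)"
proof -
  have "distr (services_law \<mu>) lborel (\<lambda>s. s j) = distr (services_law \<mu>) borel (\<lambda>s. s j)"
    by (intro distr_cong) auto
  then show ?thesis
    by (simp add: distributed_def distr_service)
qed

text \<open>The joint law of all coordinates is the law of the identity map, hence the product
  measure itself.\<close>

lemma indep_services: "indep_vars (\<lambda>_. borel) (\<lambda>j s. s j) (UNIV :: nat set)"
proof (subst indep_vars_iff_distr_eq_PiM)
  have "distr (services_law \<mu>) (Pi\<^sub>M UNIV (\<lambda>_. borel)) (\<lambda>s. \<lambda>j\<in>UNIV. s j)
      = distr (services_law \<mu>) (services_law \<mu>) (\<lambda>s. s)"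
    by (intro distr_cong) (auto simp: sets_services_law)
  also have "\<dots> = services_law \<mu>"
    by simp
  finally show "distr (services_law \<mu>) (Pi\<^sub>M UNIV (\<lambda>_. borel)) (\<lambda>s. \<lambda>j\<in>UNIV. s j)
      = Pi\<^sub>M UNIV (\<lambda>j. distr (services_law \<mu>) borel (\<lambda>s. s j))"
    by (simp add: distr_service) (simp add: services_law_def)
qed (rule UNIV_not_empty, rule borel_measurable_service)

lemma services_nonneg_AE: "AE s in services_law \<mu>. \<forall>j. 0 \<le> s j"
proof (subst AE_all_countable, rule allI)
  fix j
  have "AE t in distr (services_law \<mu>) borel (\<lambda>s. s j). 0 \<le> t"
    unfolding distr_service by (rule exponential_nonneg_AE)
  then show "AE s in services_law \<mu>. 0 \<le> s j"
    by (rule AE_distrD[rotated]) measurable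
qed

lemma prob_sum_services_le:
  assumes "0 \<le> x"
  shows "prob {s. (\<Sum>j<k. s j) \<le> x} = 1 - (\<Sum>i<k. poisson_mass (\<mu> * x) i)"
proof (cases k)
  case 0
  then show ?thesis using assms prob_space by simp
next
  case (Suc n)
  \<comment> \<open>The index of \<open>erlang_density\<close> is one less than the number of
    exponential summands. The complement of its distribution function is a Poisson sum.\<close>
  have "distributed (services_law \<mu>) lborel (\<lambda>s. \<Sum>j\<in>{..<k}. s j) (erlang_density (card {..<k} - 1) \<mu>)"
    using Suc by (intro exponential_distributed_sum rate_pos distributed_service
      indep_vars_subset[OF indep_services]) auto
  then have "distributed (services_law \<mu>) lborel (\<lambda>s. \<Sum>j<k. s j) (erlang_density n \<mu>)"
    by (simp add: Suc)
  from erlang_distributed_le[OF this rate_pos assms]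
  show ?thesis
    using assms by (simp add: erlang_CDF_def Suc lessThan_Suc_atMost poisson_mass_def mult_ac)
qed

lemma measurable_num_served [measurable]:
  assumes [measurable]: "f \<in> borel_measurable M" "g \<in> measurable M (services_law \<mu>)"
  shows "(\<lambda>w. num_served m (f w) (g w)) \<in> measurable M (count_space UNIV)"
proof -
  have [measurable]: "(\<lambda>w. g w j) \<in> borel_measurable M" for j
    using measurable_compose[OF assms(2) borel_measurable_service] .
  \<comment> \<open>The cardinality is a finite sum of measurable indicators; \<open>nat\<close> and
    the floor bring it back from the reals.\<close>
  have "(\<lambda>w. real (num_served m (f w) (g w)))
      = (\<lambda>w. \<Sum>k=1..m. if (\<Sum>j<k. g w j) \<le> f w then 1 else 0)"
    by (auto simp: num_served_def sum.If_cases Int_def)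
  also have "\<dots> \<in> borel_measurable M"
    by measurable
  finally have "(\<lambda>w. nat \<lfloor>real (num_served m (f w) (g w))\<rfloor>) \<in> measurable M (count_space UNIV)"
    by measurable
  then show ?thesis by simp
qed

lemma prob_num_served_ge:
  assumes "0 \<le> x" "k \<le> m"
  shows "prob {s. k \<le> num_served m x s} = 1 - (\<Sum>i<k. poisson_mass (\<mu> * x) i)"
proof -
  \<comment> \<open>The two events can differ only where some service time is negative, which is a
    null set.\<close>
  have "prob {s. k \<le> num_served m x s} = prob {s. (\<Sum>j<k. s j) \<le> x}"
  proof (rule measure_eq_AE)
    show "AE s in services_law \<mu>. s \<in> {s. k \<le> num_served m x s} \<longleftrightarrow> s \<in> {s. (\<Sum>j<k. s j) \<le> x}"
      using services_nonneg_AE by eventually_elim (use assms num_served_ge_iff in auto)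
    have "Measurable.pred (services_law \<mu>) (\<lambda>s. k \<le> num_served m x s)" by measurable
    then show "{s. k \<le> num_served m x s} \<in> events" by (simp add: pred_def)
    have "Measurable.pred (services_law \<mu>) (\<lambda>s. (\<Sum>j<k. s j) \<le> x)" by measurable
    then show "{s. (\<Sum>j<k. s j) \<le> x} \<in> events" by (simp add: pred_def)
  qed
  then show ?thesis
    using prob_sum_services_le[OF assms(1)] by simp
qed

end

section \<open>Transition matrix of the embedded chain\<close>

locale gi_m_1 = real_distribution A + service: service_times \<mu> for A \<mu> +
  assumes nonneg_AE: "AE x in A. 0 \<le> x"
begin

abbreviation "a \<equiv> poisson_mix A \<mu>"

lemma scaled_nonneg_AE: "AE x in A. 0 \<le> \<mu> * x"
  using nonneg_AE by eventually_elim (use service.rate_pos in simp)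

lemma integrable_poisson_mass: "integrable A (\<lambda>x. poisson_mass (\<mu> * x) k)"
proof (rule integrable_const_bound)
  show "AE x in A. norm (poisson_mass (\<mu> * x) k) \<le> 1"
    using scaled_nonneg_AE by eventually_elim (simp add: poisson_mass_nonneg poisson_mass_le_1)
qed measurable

lemma sets_num_served_ge: "{(x, s). k \<le> num_served m x s} \<in> sets (A \<Otimes>\<^sub>M services_law \<mu>)"
proof -
  have "Measurable.pred (A \<Otimes>\<^sub>M services_law \<mu>) (\<lambda>w. k \<le> num_served m (fst w) (snd w))"
    by measurable
  moreover have "{w \<in> space (A \<Otimes>\<^sub>M services_law \<mu>). k \<le> num_served m (fst w) (snd w)}
      = {(x, s). k \<le> num_served m x s}"
    by (auto simp: space_pair_measure)
  ultimately show ?thesis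
    by (simp only: pred_def)
qed

text \<open>Fubini: for a fixed interarrival time the probability is a Poisson tail, which is then
  integrated over \<open>A\<close>.\<close>

lemma prob_num_served_ge_pair:
  assumes "k \<le> m"
  shows "measure (A \<Otimes>\<^sub>M services_law \<mu>) {(x, s). k \<le> num_served m x s} = 1 - (\<Sum>i<k. a i)"
proof -
  have int: "(LINT x|A. 1 - (\<Sum>i<k. poisson_mass (\<mu> * x) i)) = 1 - (\<Sum>i<k. a i)"
    using prob_space by (subst Bochner_Integration.integral_diff)
      (auto simp: poisson_mix_def integrable_poisson_mass)
  have "emeasure (A \<Otimes>\<^sub>M services_law \<mu>) {(x, s). k \<le> num_served m x s}
      = (\<integral>\<^sup>+x. emeasure (services_law \<mu>) {s. k \<le> num_served m x s} \<partial>A)"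
    by (subst service.emeasure_pair_measure_alt, rule sets_num_served_ge) (simp add: vimage_def)
  also have "\<dots> = (\<integral>\<^sup>+x. ennreal (1 - (\<Sum>i<k. poisson_mass (\<mu> * x) i)) \<partial>A)"
    using nonneg_AE
    by (intro nn_integral_cong_AE, eventually_elim)
      (simp add: service.emeasure_eq_measure service.prob_num_served_ge assms)
  also have "\<dots> = ennreal (LINT x|A. 1 - (\<Sum>i<k. poisson_mass (\<mu> * x) i))"
  proof (rule nn_integral_eq_integral)
    show "integrable A (\<lambda>x. 1 - (\<Sum>i<k. poisson_mass (\<mu> * x) i))"
      by (intro Bochner_Integration.integrable_diff Bochner_Integration.integrable_sum
          integrable_poisson_mass) simp
    show "AE x in A. 0 \<le> 1 - (\<Sum>i<k. poisson_mass (\<mu> * x) i)"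
      using scaled_nonneg_AE by eventually_elim (simp add: sum_poisson_mass_le_1)
  qed
  also note int
  finally have "emeasure (A \<Otimes>\<^sub>M services_law \<mu>) {(x, s). k \<le> num_served m x s} = ennreal (1 - (\<Sum>i<k. a i))" .
  moreover have "0 \<le> 1 - (\<Sum>i<k. a i)"
    unfolding int[symmetric] using scaled_nonneg_AE
    by (intro integral_nonneg_AE, eventually_elim) (simp add: sum_poisson_mass_le_1)
  ultimately show ?thesis
    by (simp add: measure_def)
qed

text \<open>Difference of two consecutive tails. The bound \<open>k < m\<close> is strict because
  the count saturates at \<open>m\<close>, where the whole remaining tail is collected.\<close>

lemma prob_num_served_eq:
  assumes "k < m"
  shows "measure (A \<Otimes>\<^sub>M services_law \<mu>) {(x, s). num_served m x s = k} = a k"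
proof -
  interpret P: pair_prob_space A "services_law \<mu>" ..
  have "{(x, s). num_served m x s = k}
      = {(x, s). k \<le> num_served m x s} - {(x, s). Suc k \<le> num_served m x s}"
    by auto
  moreover have "{(x, s). Suc k \<le> num_served m x s} \<subseteq> {(x, s). k \<le> num_served m x s}"
    by auto
  ultimately have "measure (A \<Otimes>\<^sub>M services_law \<mu>) {(x, s). num_served m x s = k}
      = (1 - (\<Sum>i<k. a i)) - (1 - (\<Sum>i<Suc k. a i))"
    using assms P.finite_measure_Diff[OF sets_num_served_ge sets_num_served_ge, of "Suc k" m k m]
      prob_num_served_ge_pair[of k m] prob_num_served_ge_pair[of "Suc k" m]
    by (auto simp del: sum.lessThan_Suc)
  then show ?thesis by simp
qed

text \<open>A state \<open>j > 0\<close> fixes the number of services below saturation, giving a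
  single \<open>a\<close>; state \<open>0\<close> means that everybody present was served, giving a
  tail.\<close>

lemma transition_prob_eq:
  defines "i' \<equiv> \<lambda>n i. min (i + 1) n"
  shows "transition_prob A \<mu> n i j =
    (if i' n i < j then 0 else if j = 0 then 1 - (\<Sum>k<i' n i. a k) else a (i' n i - j))"
proof -
  let ?m = "i' n i"
  have "transition_prob A \<mu> n i j
      = measure (A \<Otimes>\<^sub>M services_law \<mu>) {(x, s). ?m - num_served ?m x s = j}"
    by (simp add: transition_prob_def next_found_def space_pair_measure i'_def)
  also have "{(x, s). ?m - num_served ?m x s = j} =
      (if ?m < j then {} else if j = 0 then {(x, s). ?m \<le> num_served ?m x s}
       else {(x, s). num_served ?m x s = ?m - j})"
  proof -
    have "?m - num_served ?m x s = j \<longleftrightarrow> num_served ?m x s = ?m - j" if "j \<le> ?m" "0 < j" for x s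
      using num_served_le[of ?m x s] that by linarith
    then show ?thesis
      by (auto simp: not_less)
  qed
  finally show ?thesis
    by (simp add: prob_num_served_eq prob_num_served_ge_pair)
qed

end

section \<open>Generating functions\<close>

text \<open>Supplies the dominating function for the second-order limit at load \<open>1\<close>.
  The difference of the two sides vanishes at \<open>0\<close> and has derivative
  \<open>x + exp (- x) - 1 \<ge> 0\<close>.\<close>

lemma exp_minus_le_quadratic:
  fixes u :: real
  assumes "0 \<le> u"
  shows "exp (- u) - 1 + u \<le> u\<^sup>2 / 2"
proof -
  define F where "F = (\<lambda>u :: real. u\<^sup>2 / 2 - (exp (- u) - 1 + u))"
  have "F 0 \<le> F u"
  proof (rule DERIV_nonneg_imp_nondecreasing[OF assms])
    fix x :: real assume "0 \<le> x"
    have "(F has_real_derivative (x + exp (- x) - 1)) (at x)"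
      unfolding F_def by (auto intro!: derivative_eq_intros)
    moreover have "0 \<le> x + exp (- x) - 1"
      using exp_ge_add_one_self[of "- x"] by linarith
    ultimately show "\<exists>y. (F has_real_derivative y) (at x) \<and> 0 \<le> y"
      by blast
  qed
  then show ?thesis by (simp add: F_def)
qed

locale gi_m_1_mean = gi_m_1 +
  assumes integrable_id: "integrable A (\<lambda>x. x)" and mean_pos: "0 < (LINT x|A. x)"
begin

text \<open>The reciprocal of the load \<open>\<rho>\<close>.\<close>

abbreviation "\<theta> \<equiv> \<mu> * (LINT x|A. x)"

lemma \<theta>_pos: "0 < \<theta>"
  using mean_pos service.rate_pos by simp

lemma mix_pos: "0 < a k"
proof -
  have nonneg: "AE x in A. 0 \<le> poisson_mass (\<mu> * x) k"
    using scaled_nonneg_AE by eventually_elim (rule poisson_mass_nonneg)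
  have "a k \<noteq> 0"
  proof
    assume "a k = 0"
    then have "AE x in A. poisson_mass (\<mu> * x) k = 0"
      \<comment> \<open>A Poisson mass vanishes at most for parameter \<open>0\<close>, so a zero
        integral would concentrate \<open>A\<close> at \<open>0\<close>, against the positive
        mean.\<close>
      unfolding poisson_mix_def using integral_nonneg_eq_0_iff_AE[OF integrable_poisson_mass nonneg] by simp
    then have "AE x in A. x = 0"
      by eventually_elim (use service.rate_pos in \<open>simp add: poisson_mass_def\<close>)
    then have "(LINT x|A. x) = (LINT x|A. 0)"
      by (intro integral_cong_AE) auto
    then show False
      using mean_pos by simp
  qed
  moreover have "0 \<le> a k"
    unfolding poisson_mix_def using nonneg by (rule integral_nonneg_AE)
  ultimately show ?thesis by simp
qed

text \<open>The generating function of the Poisson law is integrated term by term; the integrals of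
  the absolute values are summable since the partial sums of \<open>a\<close> are at most
  \<open>1\<close>.\<close>

lemma mix_powser_sums:
  assumes z: "0 \<le> z" "z \<le> 1"
  shows "(\<lambda>k. a k * z ^ k) sums laplace_stieltjes A (\<mu> - \<mu> * z)"
proof -
  have int: "integrable A (\<lambda>x. poisson_mass (\<mu> * x) k * z ^ k)" for k
    by (intro integrable_mult_left integrable_poisson_mass)
  have norm_int: "(LINT x|A. norm (poisson_mass (\<mu> * x) k * z ^ k)) = a k * z ^ k" for k
  proof -
    have "(LINT x|A. norm (poisson_mass (\<mu> * x) k * z ^ k)) = (LINT x|A. poisson_mass (\<mu> * x) k * z ^ k)"
      using scaled_nonneg_AE z by (intro integral_cong_AE)
        (auto elim!: eventually_mono simp: poisson_mass_nonneg)
    then show ?thesis by (simp add: poisson_mix_def)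
  qed
  have "(\<Sum>k<n. a k) \<le> 1" for n
  proof -
    have "(\<Sum>k<n. a k) = (LINT x|A. (\<Sum>k<n. poisson_mass (\<mu> * x) k))"
      by (simp add: poisson_mix_def integrable_poisson_mass)
    also have "\<dots> \<le> (LINT x|A. 1)"
      using scaled_nonneg_AE
      by (intro integral_mono_AE Bochner_Integration.integrable_sum integrable_poisson_mass)
        (auto elim!: eventually_mono intro!: sum_poisson_mass_le_1)
    finally show ?thesis using prob_space by simp
  qed
  then have "summable a"
    using mix_pos by (intro summableI_nonneg_bounded) (auto intro: less_imp_le)
  then have "summable (\<lambda>k. a k * z ^ k)"
    by (rule summable_comparison_test')
      (use z mix_pos in \<open>auto simp: abs_mult less_imp_le abs_of_pos intro!: mult_left_le power_le_one\<close>)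
  then have "(\<lambda>k. LINT x|A. poisson_mass (\<mu> * x) k * z ^ k) sums
      (LINT x|A. (\<Sum>k. poisson_mass (\<mu> * x) k * z ^ k))"
  proof (intro sums_integral int)
    show "AE x in A. summable (\<lambda>k. norm (poisson_mass (\<mu> * x) k * z ^ k))"
      using scaled_nonneg_AE
    proof eventually_elim
      case (elim x)
      then show ?case
        using sums_summable[OF poisson_mass_powser_sums[of "\<mu> * x" z]] z
        by (simp add: abs_mult poisson_mass_nonneg)
    qed
    show "summable (\<lambda>k. LINT x|A. norm (poisson_mass (\<mu> * x) k * z ^ k))"
      unfolding norm_int by fact
  qed
  moreover have "(\<Sum>k. poisson_mass (\<mu> * x) k * z ^ k) = exp (- (\<mu> - \<mu> * z) * x)" for x
    using poisson_mass_powser_sums[of "\<mu> * x" z] by (simp add: sums_iff algebra_simps)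
  ultimately show ?thesis
    by (simp add: poisson_mix_def laplace_stieltjes_def)
qed

lemma mix_sums: "a sums 1"
  using mix_powser_sums[of 1] prob_space by (simp add: laplace_stieltjes_def)

lemma mix_le_1: "\<bar>a k\<bar> \<le> 1"
  using mix_sums mix_pos sum_le_suminf[of a "{k}"] by (simp add: sums_iff less_imp_le abs_of_pos)

abbreviation "\<alpha>f \<equiv> Abs_fps a"

lemma eval_mix: "0 \<le> z \<Longrightarrow> z < 1 \<Longrightarrow> eval_fps \<alpha>f z = laplace_stieltjes A (\<mu> - \<mu> * z)"
  using mix_powser_sums[of z] by (simp add: eval_fps_def sums_iff)

section \<open>The tails of \<open>a\<close> and their sums\<close>

definition b :: "nat \<Rightarrow> real" where
  "b = fps_nth (tail_fps 1 a)"

abbreviation "\<beta>f \<equiv> Abs_fps b"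

lemma one_minus_\<alpha>f: "1 - \<alpha>f = (1 - fps_X) * \<beta>f"
  using fps_const_minus_Abs_fps_eq_tail[of a 1] mix_sums
  by (simp add: sums_iff b_def fps_nth_inverse)

lemma \<alpha>f_minus_X: "\<alpha>f - fps_X = (1 - fps_X) * (1 - \<beta>f)"
  using one_minus_\<alpha>f by (simp add: algebra_simps)

lemma b_pos: "0 < b k"
  unfolding b_def using mix_pos mix_sums by (intro tail_fps_pos) (auto simp: sums_iff)

lemma b_eq: "b n = 1 - (\<Sum>k\<le>n. a k)"
proof -
  have "\<beta>f $ n = (\<Sum>k\<le>n. (1 - \<alpha>f) $ k)"
    using one_minus_\<alpha>f by (intro fps_nth_eq_partial_sum) simp
  then show ?thesis
    by (simp add: sum_subtractf)
qed

lemma b_0: "b 0 = 1 - a 0" "b 0 < 1"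
  using mix_pos[of 0] by (simp_all add: b_eq)

lemma b_le_1: "\<bar>b k\<bar> \<le> 1"
  using b_pos[of k] mix_pos by (simp add: b_eq abs_le_iff sum_nonneg less_imp_le)

lemma eval_\<beta>f:
  assumes "\<bar>z\<bar> < 1"
  shows "1 - eval_fps \<alpha>f z = (1 - z) * eval_fps \<beta>f z"
  using one_minus_\<alpha>f mix_le_1 b_le_1 assms
  by (intro eval_fps_tail[of _ _ _ _ 1 1]) auto

lemma eval_\<beta>f_sums: "\<bar>z\<bar> < 1 \<Longrightarrow> (\<lambda>k. b k * z ^ k) sums eval_fps \<beta>f z"
  using sums_eval_fps[OF fps_conv_radius_gt[of \<beta>f 1 z]] b_le_1 by simp

text \<open>Series at \<open>1\<close> are evaluated by Abel summation along the points \<open>1 - h n\<close>.\<close>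

definition h :: "nat \<Rightarrow> real" where
  "h n = 1 / (real n + 2)"

lemma h: "0 < h n" "h n < 1"
  by (auto simp: h_def field_simps)

lemma h_tendsto: "h \<longlonglongrightarrow> 0"
  unfolding h_def by real_asymp

lemma integrable_exp:
  assumes "0 \<le> c"
  shows "integrable A (\<lambda>x. exp (- (\<mu> * x * c)))"
proof (rule integrable_const_bound)
  show "AE x in A. norm (exp (- (\<mu> * x * c))) \<le> 1"
    using scaled_nonneg_AE by eventually_elim (use assms in simp)
qed measurable

text \<open>At \<open>1 - h\<close> the series of \<open>b\<close> equals
  \<open>(1 - \<alpha>(\<mu> h)) / h\<close>, the integral of
  \<open>(1 - exp (- (\<mu> * x * h))) / h\<close>. The integrand is dominated by
  \<open>\<mu> * x\<close> and tends to it.\<close>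

lemma b_sums: "b sums \<theta>"
proof (rule nonneg_power_series_limit_sums)
  show "0 \<le> b k" for k using b_pos[of k] by simp
  show "0 < 1 - h n" "1 - h n < 1" for n using h[of n] by auto
  show "(\<lambda>n. 1 - h n) \<longlonglongrightarrow> 1"
    using tendsto_diff[OF tendsto_const h_tendsto, of 1] by simp
  show "(\<lambda>k. b k * (1 - h n) ^ k) sums (LINT x|A. (1 - exp (- (\<mu> * x * h n))) / h n)" for n
  proof -
    have "eval_fps \<beta>f (1 - h n) = (1 - laplace_stieltjes A (\<mu> * h n)) / h n"
      using eval_\<beta>f[of "1 - h n"] eval_mix[of "1 - h n"] h[of n]
      by (simp add: right_diff_distrib nonzero_eq_divide_eq mult.commute)
    also have "\<dots> = (LINT x|A. (1 - exp (- (\<mu> * x * h n))) / h n)"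
      using integrable_exp[of "h n"] h[of n] prob_space
      by (simp add: laplace_stieltjes_def mult_ac)
    finally have eq: "eval_fps \<beta>f (1 - h n) = (LINT x|A. (1 - exp (- (\<mu> * x * h n))) / h n)" .
    have "\<bar>1 - h n\<bar> < 1"
      using h[of n] by simp
    from eval_\<beta>f_sums[OF this] show ?thesis
      by (simp only: eq)
  qed
  have "(\<lambda>n. LINT x|A. (1 - exp (- (\<mu> * x * h n))) / h n) \<longlonglongrightarrow> (LINT x|A. \<mu> * x)"
  proof (rule integral_dominated_convergence)
    show "integrable A (\<lambda>x. \<mu> * x)"
      using integrable_id by simp
    show "AE x in A. (\<lambda>n. (1 - exp (- (\<mu> * x * h n))) / h n) \<longlonglongrightarrow> \<mu> * x"
    proof (rule AE_I2)
      fix x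
      have "(\<lambda>n. (1 - exp (- (t * h n))) / h n) \<longlonglongrightarrow> t" for t :: real
        unfolding h_def by real_asymp
      then show "(\<lambda>n. (1 - exp (- (\<mu> * x * h n))) / h n) \<longlonglongrightarrow> \<mu> * x" .
    qed
    show "AE x in A. norm ((1 - exp (- (\<mu> * x * h n))) / h n) \<le> \<mu> * x" for n
      using scaled_nonneg_AE
    proof eventually_elim
      case (elim x)
      have "exp (- (\<mu> * x * h n)) \<le> 1"
        using elim h[of n] by simp
      moreover have "1 - exp (- (\<mu> * x * h n)) \<le> \<mu> * x * h n"
        using exp_ge_add_one_self[of "- (\<mu> * x * h n)"] by linarith
      ultimately show ?case
        using h[of n] by (simp add: divide_le_eq)
    qed
  qed measurable
  then show "(\<lambda>n. LINT x|A. (1 - exp (- (\<mu> * x * h n))) / h n) \<longlonglongrightarrow> \<theta>"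
    by simp
qed

text \<open>At load \<open>1\<close> the sequence \<open>b\<close> is itself a probability
  distribution, so its tails divide out a second factor \<open>1 - X\<close>. Their series at
  \<open>1 - h\<close> is \<open>(\<alpha>(\<mu> h) - 1 + h) / h\<^sup>2\<close>; the linear term is
  matched exactly by \<open>\<theta> = 1\<close>, and half the second moment of
  \<open>\<mu> * x\<close> remains in the limit.\<close>

lemma tail_of_b_critical:
  assumes \<theta>: "\<theta> = 1" and int2: "integrable A (\<lambda>x. x ^ 2)"
  shows "fps_nth (tail_fps 1 b) sums (rho_moment A \<mu> 2 / 2)"
    "1 - \<beta>f = (1 - fps_X) * tail_fps 1 b"
proof -
  let ?R = "tail_fps 1 b"
  show R: "1 - \<beta>f = (1 - fps_X) * ?R"
    using fps_const_minus_Abs_fps_eq_tail[of b 1] b_sums \<theta>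
    by (simp add: sums_iff)
  have R_eq: "?R $ n = 1 - (\<Sum>k\<le>n. b k)" for n
  proof -
    have "?R $ n = (\<Sum>k\<le>n. (1 - \<beta>f) $ k)"
      using R by (intro fps_nth_eq_partial_sum) simp
    then show ?thesis
      by (simp add: sum_subtractf)
  qed
  have R_pos: "0 < ?R $ n" for n
    using b_pos b_sums by (intro tail_fps_pos) (auto simp: sums_iff)
  have R_bound: "\<bar>?R $ n\<bar> \<le> 1" for n
    using R_pos[of n] b_pos by (simp add: R_eq abs_le_iff sum_nonneg less_imp_le)
  define g where "g n = (LINT x|A. (exp (- (\<mu> * x * h n)) - 1 + \<mu> * x * h n) / (h n)\<^sup>2)" for n
  show "fps_nth ?R sums (rho_moment A \<mu> 2 / 2)"
  proof (rule nonneg_power_series_limit_sums)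
    show "0 \<le> ?R $ k" for k using R_pos[of k] by simp
    show "0 < 1 - h n" "1 - h n < 1" for n using h[of n] by auto
    show "(\<lambda>n. 1 - h n) \<longlonglongrightarrow> 1"
      using tendsto_diff[OF tendsto_const h_tendsto, of 1] by simp
    show "(\<lambda>k. ?R $ k * (1 - h n) ^ k) sums g n" for n
    proof -
      have small: "\<bar>1 - h n\<bar> < 1"
        using h[of n] by simp
      have B: "1 - eval_fps \<beta>f (1 - h n) = h n * eval_fps ?R (1 - h n)"
        using eval_fps_tail[of 1 \<beta>f 1 ?R 1 1 "1 - h n"] R b_le_1 R_bound small by simp
      have L: "1 - laplace_stieltjes A (\<mu> * h n) = h n * eval_fps \<beta>f (1 - h n)"
        using eval_\<beta>f[OF small] eval_mix[of "1 - h n"] h[of n]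
        by (simp add: right_diff_distrib)
      have "laplace_stieltjes A (\<mu> * h n) - 1 + h n = h n * (1 - eval_fps \<beta>f (1 - h n))"
        using L by (simp add: right_diff_distrib)
      then have "laplace_stieltjes A (\<mu> * h n) - 1 + h n = (h n)\<^sup>2 * eval_fps ?R (1 - h n)"
        by (simp only: B power2_eq_square mult.assoc)
      moreover have "g n = (laplace_stieltjes A (\<mu> * h n) - 1 + h n) / (h n)\<^sup>2"
      proof -
        have "(LINT x|A. exp (- (\<mu> * x * h n)) - 1 + \<mu> * x * h n)
            = (LINT x|A. exp (- (\<mu> * x * h n))) - 1 + \<theta> * h n"
          using integrable_exp[of "h n"] integrable_id h[of n] prob_space
          by (simp add: mult_ac)
        then show ?thesis
          using \<theta> by (simp add: g_def laplace_stieltjes_def mult_ac)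
      qed
      ultimately have "g n = eval_fps ?R (1 - h n)"
        using h[of n] by simp
      then show ?thesis
        using sums_eval_fps[OF fps_conv_radius_gt[of ?R 1 "1 - h n", OF R_bound small]] by simp
    qed
    have "g \<longlonglongrightarrow> (LINT x|A. (\<mu> * x)\<^sup>2 / 2)"
      unfolding g_def
    proof (rule integral_dominated_convergence)
      show "integrable A (\<lambda>x. (\<mu> * x)\<^sup>2 / 2)"
        using int2 by (simp add: power_mult_distrib)
      show "AE x in A. (\<lambda>n. (exp (- (\<mu> * x * h n)) - 1 + \<mu> * x * h n) / (h n)\<^sup>2) \<longlonglongrightarrow> (\<mu> * x)\<^sup>2 / 2"
      proof (rule AE_I2)
        fix x
        have "(\<lambda>n. (exp (- (t * h n)) - 1 + t * h n) / (h n)\<^sup>2) \<longlonglongrightarrow> t\<^sup>2 / 2" for t :: real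
          unfolding h_def power2_eq_square[of t] by real_asymp
        then show "(\<lambda>n. (exp (- (\<mu> * x * h n)) - 1 + \<mu> * x * h n) / (h n)\<^sup>2) \<longlonglongrightarrow> (\<mu> * x)\<^sup>2 / 2" .
      qed
      show "AE x in A. norm ((exp (- (\<mu> * x * h n)) - 1 + \<mu> * x * h n) / (h n)\<^sup>2) \<le> (\<mu> * x)\<^sup>2 / 2" for n
        using scaled_nonneg_AE
      proof eventually_elim
        case (elim x)
        define u where "u = \<mu> * x * h n"
        have "0 \<le> u" using elim h[of n] by (simp add: u_def)
        then have le: "exp (- u) - 1 + u \<le> u\<^sup>2 / 2" and "0 \<le> exp (- u) - 1 + u"
          using exp_minus_le_quadratic exp_ge_add_one_self[of "- u"] by auto
        then have "\<bar>(exp (- u) - 1 + u) / (h n)\<^sup>2\<bar> = (exp (- u) - 1 + u) / (h n)\<^sup>2"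
          by (intro abs_of_nonneg divide_nonneg_nonneg) auto
        also have "\<dots> \<le> u\<^sup>2 / 2 / (h n)\<^sup>2"
          using le by (rule divide_right_mono) simp
        also have "\<dots> = (\<mu> * x)\<^sup>2 / 2"
          using h[of n] by (simp add: u_def power_mult_distrib)
        finally show ?case by (simp add: u_def)
      qed
    qed measurable
    also have "(LINT x|A. (\<mu> * x)\<^sup>2 / 2) = rho_moment A \<mu> 2 / 2"
      by (simp add: rho_moment_def power_mult_distrib)
    finally show "g \<longlonglongrightarrow> rho_moment A \<mu> 2 / 2" .
  qed
qed

section \<open>The stationary distribution\<close>

definition \<pi>f :: "real fps" where
  "\<pi>f = \<alpha>f * inverse (1 - \<beta>f)"

definition S :: "nat \<Rightarrow> real" where
  "S n = (\<Sum>k\<le>n. \<pi>f $ k)"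

lemma \<pi>f_mult: "\<pi>f * (1 - \<beta>f) = \<alpha>f"
proof -
  have "\<pi>f * (1 - \<beta>f) = \<alpha>f * ((1 - \<beta>f) * inverse (1 - \<beta>f))"
    by (simp add: \<pi>f_def mult_ac)
  then show ?thesis
    using b_0 by (simp add: fps_one_minus_inverse)
qed

lemma \<pi>f_nonneg: "0 \<le> \<pi>f $ n"
  unfolding \<pi>f_def fps_mult_nth using mix_pos b_pos b_0
  by (intro sum_nonneg mult_nonneg_nonneg fps_inverse_one_minus_nonneg) (auto intro: less_imp_le)

lemma \<pi>f_0: "\<pi>f $ 0 = 1"
proof -
  have "\<pi>f $ 0 * (1 - b 0) = a 0"
    using arg_cong[OF \<pi>f_mult, of "\<lambda>f. f $ 0"] by simp
  then show ?thesis
    using b_0 mix_pos[of 0] by simp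
qed

text \<open>The coefficient of \<open>X ^ Suc k\<close> in
  \<open>\<pi>f * (\<alpha>f - X) = (1 - X) * \<alpha>f\<close>. As \<open>\<pi>f $ 0 = 1\<close>,
  the summand \<open>l = 0\<close> cancels \<open>a (Suc k)\<close>. This is the balance equation of
  state \<open>n - k\<close>, scaled to mass \<open>1\<close> at \<open>n\<close>.\<close>

lemma \<pi>f_rec: "\<pi>f $ k = a k + (\<Sum>l=1..Suc k. \<pi>f $ l * a (Suc k - l))"
proof -
  have "\<pi>f * (\<alpha>f - fps_X) = (1 - fps_X) * \<alpha>f"
    unfolding \<alpha>f_minus_X using \<pi>f_mult by (metis mult.left_commute)
  then have "(\<pi>f * \<alpha>f) $ Suc k - (fps_X * \<pi>f) $ Suc k = (\<alpha>f - fps_X * \<alpha>f) $ Suc k"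
    by (metis fps_sub_nth left_diff_distrib mult.commute mult_1 right_diff_distrib)
  then have "(\<pi>f * \<alpha>f) $ Suc k - \<pi>f $ k = a (Suc k) - a k"
    by simp
  moreover have "(\<pi>f * \<alpha>f) $ Suc k = (\<Sum>l=0..Suc k. \<pi>f $ l * a (Suc k - l))"
    by (simp only: fps_mult_nth fps_nth_Abs_fps)
  ultimately have "(\<Sum>l=0..Suc k. \<pi>f $ l * a (Suc k - l)) - \<pi>f $ k = a (Suc k) - a k"
    by simp
  then show ?thesis
    by (subst (asm) sum.atLeast_Suc_atMost) (simp_all add: \<pi>f_0)
qed

lemma S_ge_1: "1 \<le> S n"
  unfolding S_def using \<pi>f_nonneg \<pi>f_0 member_le_sum[of 0 "{..n}" "fps_nth \<pi>f"] by simp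

lemma transition_prob_column_sum:
  fixes q :: "nat \<Rightarrow> real"
  assumes k: "k < n"
  shows "(\<Sum>i\<le>n. q i * transition_prob A \<mu> n i (n - k))
    = q n * a k + (\<Sum>l=1..Suc k. q (n - l) * a (Suc k - l))"
proof -
  let ?t = "\<lambda>l. q (n - l) * transition_prob A \<mu> n (n - l) (n - k)"
  have "(\<Sum>i\<le>n. q i * transition_prob A \<mu> n i (n - k)) = (\<Sum>l\<le>n. ?t l)"
    using sum.nat_diff_reindex[of "\<lambda>i. q i * transition_prob A \<mu> n i (n - k)" "Suc n"]
    by (simp add: lessThan_Suc_atMost)
  also have "\<dots> = ?t 0 + (\<Sum>l=1..n. ?t l)"
    by (simp add: atMost_atLeast0 sum.atLeast_Suc_atMost)
  also have "?t 0 = q n * a k"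
    using k by (simp add: transition_prob_eq)
  also have "(\<Sum>l=1..n. ?t l) = (\<Sum>l=1..Suc k. q (n - l) * a (Suc k - l))"
  proof (rule sum.mono_neutral_cong_right)
    show "\<forall>l\<in>{1..n} - {1..Suc k}. ?t l = 0"
      by (auto simp: transition_prob_eq)
    fix l assume "l \<in> {1..Suc k}"
    then have "min (n - l + 1) n = Suc n - l" "\<not> Suc n - l < n - k" "Suc n - l - (n - k) = Suc k - l" "n - k \<noteq> 0"
      using k by auto
    then show "?t l = q (n - l) * a (Suc k - l)"
      by (simp add: transition_prob_eq)
  qed (use k in auto)
  finally show ?thesis .
qed

lemma sum_transition_prob: "(\<Sum>j\<le>n. transition_prob A \<mu> n i j) = 1"
proof -
  define m where "m = min (i + 1) n"
  have "(\<Sum>j\<le>n. transition_prob A \<mu> n i j) = transition_prob A \<mu> n i 0 + (\<Sum>j=1..n. transition_prob A \<mu> n i j)"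
    by (simp add: atMost_atLeast0 sum.atLeast_Suc_atMost)
  also have "(\<Sum>j=1..n. transition_prob A \<mu> n i j) = (\<Sum>j=1..m. a (m - j))"
    by (rule sum.mono_neutral_cong_right) (auto simp: transition_prob_eq m_def)
  also have "(\<Sum>j=1..m. a (m - j)) = (\<Sum>j<m. a j)"
    by (rule sum.reindex_bij_witness[of _ "\<lambda>j. m - j" "\<lambda>j. m - j"]) auto
  finally show ?thesis
    by (simp add: transition_prob_eq m_def)
qed

lemma stationary_pmf_eq:
  assumes q: "stationary A \<mu> n q" and j: "j \<le> n"
  shows "pmf q j = \<pi>f $ (n - j) / S n"
proof -
  have step: "pmf q (n - k) = pmf q n * a k + (\<Sum>l=1..Suc k. pmf q (n - l) * a (Suc k - l))" if "k < n" for k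
    using q that transition_prob_column_sum[of k n "pmf q"] by (simp add: stationary_def)
  have eq: "pmf q (n - k) = pmf q n * \<pi>f $ k" if "k \<le> n" for k
    using that
  proof (induction k rule: less_induct)
    case (less k)
    show ?case
    proof (cases k)
      case 0
      then show ?thesis by (simp add: \<pi>f_0)
    next
      case (Suc k')
      \<comment> \<open>The last summand, \<open>l = Suc k'\<close>, holds the unknown
        \<open>pmf q (n - k)\<close> with coefficient \<open>a 0 > 0\<close>. Balance at
        \<open>n - k'\<close> therefore determines it from higher states by the same recursion as
        \<open>\<pi>f\<close>.\<close>
      have "(\<Sum>l=1..k'. pmf q (n - l) * a (Suc k' - l)) = (\<Sum>l=1..k'. pmf q n * \<pi>f $ l * a (Suc k' - l))"
        using less Suc by (intro sum.cong) auto
      then have "pmf q n * \<pi>f $ k' = pmf q n * a k' + (pmf q n * (\<Sum>l=1..k'. \<pi>f $ l * a (Suc k' - l))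
          + pmf q (n - k) * a 0)"
        using step[of k'] less.IH[of k'] less.prems Suc by (simp add: sum_distrib_left mult.assoc)
      moreover have "pmf q n * \<pi>f $ k' = pmf q n * (a k' + ((\<Sum>l=1..k'. \<pi>f $ l * a (Suc k' - l)) + \<pi>f $ k * a 0))"
        by (subst \<pi>f_rec) (simp add: Suc)
      ultimately have "pmf q n * \<pi>f $ k * a 0 = pmf q (n - k) * a 0"
        by (simp add: algebra_simps)
      then show ?thesis
        using mix_pos[of 0] by simp
    qed
  qed
  have "1 = (\<Sum>i\<le>n. pmf q i)"
    using q by (intro sum_pmf_eq_1[symmetric]) (auto simp: stationary_def)
  also have "\<dots> = (\<Sum>k\<le>n. pmf q (n - k))"
    using sum.nat_diff_reindex[of "pmf q" "Suc n"] by (simp add: lessThan_Suc_atMost)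
  also have "\<dots> = pmf q n * S n"
    using eq by (simp add: S_def sum_distrib_left)
  finally have "pmf q n = 1 / S n"
    using S_ge_1[of n] by (simp add: field_simps)
  then show ?thesis
    using eq[of "n - j"] j by simp
qed

lemma stationary_exists: "\<exists>q. stationary A \<mu> n q"
proof -
  define f where "f j = (if j \<le> n then \<pi>f $ (n - j) / S n else 0)" for j
  have f_nonneg: "0 \<le> f j" for j
    using \<pi>f_nonneg S_ge_1[of n] by (simp add: f_def)
  have f_sum: "(\<Sum>j\<le>n. f j) = 1"
  proof -
    have "(\<Sum>j\<le>n. f j) = (\<Sum>k\<le>n. f (n - k))"
      using sum.nat_diff_reindex[of f "Suc n"] by (simp add: lessThan_Suc_atMost)
    also have "\<dots> = (\<Sum>k\<le>n. \<pi>f $ k / S n)"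
      by (intro sum.cong) (auto simp: f_def)
    also have "\<dots> = S n / S n"
      by (simp only: S_def sum_divide_distrib[symmetric])
    finally show ?thesis
      using S_ge_1[of n] by simp
  qed
  define q where "q = embed_pmf f"
  have pmf_q: "pmf q j = f j" for j
    unfolding q_def
  proof (rule pmf_embed_pmf[OF f_nonneg])
    have "(\<integral>\<^sup>+ j. ennreal (f j) \<partial>count_space UNIV) = (\<Sum>j\<le>n. ennreal (f j))"
      by (intro nn_integral_count_space') (auto simp: f_def)
    also have "\<dots> = 1"
      using f_nonneg f_sum by (simp add: sum_ennreal)
    finally show "(\<integral>\<^sup>+ j. ennreal (f j) \<partial>count_space UNIV) = 1" .
  qed
  have pos: "f j = (\<Sum>i\<le>n. f i * transition_prob A \<mu> n i j)" if "0 < j" "j \<le> n" for j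
  proof -
    define k where "k = n - j"
    have k: "k < n" "j = n - k"
      using that by (auto simp: k_def)
    have "(\<Sum>i\<le>n. f i * transition_prob A \<mu> n i j)
        = f n * a k + (\<Sum>l=1..Suc k. f (n - l) * a (Suc k - l))"
      using transition_prob_column_sum[OF k(1), of f] k(2) by simp
    also have "(\<Sum>l=1..Suc k. f (n - l) * a (Suc k - l)) = (\<Sum>l=1..Suc k. \<pi>f $ l * a (Suc k - l)) / S n"
      unfolding sum_divide_distrib using k by (intro sum.cong) (auto simp: f_def)
    also have "f n * a k = a k / S n"
      by (simp add: f_def \<pi>f_0)
    also have "a k / S n + (\<Sum>l=1..Suc k. \<pi>f $ l * a (Suc k - l)) / S n = \<pi>f $ k / S n"
      unfolding add_divide_distrib[symmetric] \<pi>f_rec[symmetric] ..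
    also have "\<dots> = f j"
      using k by (simp add: f_def)
    finally show ?thesis ..
  qed
  \<comment> \<open>The recursion covers only \<open>j > 0\<close>. Balance at \<open>0\<close>
    follows by summing over all \<open>j\<close>: rows of the transition matrix sum to
    \<open>1\<close>, so both sides have the same total, and all other equations hold.\<close>
  have zero: "f 0 = (\<Sum>i\<le>n. f i * transition_prob A \<mu> n i 0)"
  proof -
    have split: "(\<Sum>j\<le>n. g j) = g 0 + (\<Sum>j=1..n. g j)" for g :: "nat \<Rightarrow> real"
      by (simp add: atMost_atLeast0 sum.atLeast_Suc_atMost)
    have "(\<Sum>j\<le>n. \<Sum>i\<le>n. f i * transition_prob A \<mu> n i j) = (\<Sum>i\<le>n. \<Sum>j\<le>n. f i * transition_prob A \<mu> n i j)"
      by (rule sum.swap)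
    also have "\<dots> = (\<Sum>j\<le>n. f j)"
      by (simp add: sum_distrib_left[symmetric] sum_transition_prob)
    also have "(\<Sum>j\<le>n. \<Sum>i\<le>n. f i * transition_prob A \<mu> n i j)
        = (\<Sum>i\<le>n. f i * transition_prob A \<mu> n i 0) + (\<Sum>j=1..n. f j)"
      unfolding split[of "\<lambda>j. \<Sum>i\<le>n. f i * transition_prob A \<mu> n i j"]
      by (intro arg_cong2[where f = "(+)"] refl sum.cong pos[symmetric]) auto
    finally show ?thesis
      unfolding split[of f] by simp
  qed
  have "stationary A \<mu> n q"
    unfolding stationary_def
  proof (intro conjI allI impI)
    show "set_pmf q \<subseteq> {..n}"
      by (auto simp: set_pmf_iff pmf_q f_def split: if_splits)
    show "pmf q j = (\<Sum>i\<le>n. pmf q i * transition_prob A \<mu> n i j)" if "j \<le> n" for j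
      unfolding pmf_q using zero pos[of j] that by (cases "j = 0") auto
  qed
  then show ?thesis ..
qed

lemma loss_prob_eq: "loss_prob A \<mu> n = 1 / S n"
proof -
  have "\<exists>!q. stationary A \<mu> n q"
  proof (rule ex_ex1I[OF stationary_exists])
    fix q q' assume q: "stationary A \<mu> n q" "stationary A \<mu> n q'"
    show "q = q'"
    proof (rule pmf_eqI)
      fix j
      show "pmf q j = pmf q' j"
      proof (cases "j \<le> n")
        case True
        then show ?thesis
          using q by (simp add: stationary_pmf_eq)
      next
        case False
        then have "j \<notin> set_pmf q" "j \<notin> set_pmf q'"
          using q by (auto simp: stationary_def)
        then show ?thesis
          by (metis pmf_eq_0_set_pmf)
      qed
    qed
  qed
  then have "stationary A \<mu> n (THE q. stationary A \<mu> n q)"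
    by (rule theI')
  then show ?thesis
    by (simp add: loss_prob_def stationary_pmf_eq \<pi>f_0)
qed

section \<open>Asymptotics\<close>

lemma one_minus_X_S: "(1 - fps_X) * Abs_fps S = \<pi>f"
  unfolding S_def by (rule fps_one_minus_X_mult_partial_sums)

lemma S_mult: "(\<alpha>f - fps_X) * Abs_fps S = \<alpha>f"
proof -
  have "(\<alpha>f - fps_X) * Abs_fps S = ((1 - fps_X) * Abs_fps S) * (1 - \<beta>f)"
    by (simp add: \<alpha>f_minus_X mult_ac)
  then show ?thesis
    by (simp add: one_minus_X_S \<pi>f_mult)
qed

text \<open>Since \<open>a\<close> is a probability distribution, convolution with it preserves the
  limit of the coefficients.\<close>

lemma mix_convolution_tendsto:
  assumes "fps_nth g \<longlonglongrightarrow> L"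
  shows "fps_nth (\<alpha>f * g) \<longlonglongrightarrow> L"
proof -
  have "(\<lambda>n. \<Sum>i\<le>n. a i * g $ (n - i)) \<longlonglongrightarrow> suminf a * L"
    using mix_sums mix_pos by (intro tendsto_convolution assms) (simp add: abs_of_pos sums_iff)
  moreover have "(\<lambda>n. \<Sum>i\<le>n. a i * g $ (n - i)) = fps_nth (\<alpha>f * g)"
    by (simp add: fun_eq_iff fps_mult_nth atLeast0AtMost)
  ultimately show ?thesis
    using mix_sums by (simp add: sums_iff)
qed

text \<open>The renewal theorem for \<open>b\<close> makes the coefficients of \<open>\<pi>f\<close>
  converge to \<open>1 / m\<close>; Cesaro averaging carries this over to
  \<open>S n / n\<close>.\<close>

lemma loss_prob_critical:
  assumes \<theta>: "\<theta> = 1" and int2: "integrable A (\<lambda>x. x ^ 2)"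
  shows "(\<lambda>n. real n * loss_prob A \<mu> n) \<longlonglongrightarrow> rho_moment A \<mu> 2 / 2"
proof -
  define m where "m = rho_moment A \<mu> 2 / 2"
  have R: "fps_nth (tail_fps 1 b) sums m"
    unfolding m_def by (rule tail_of_b_critical(1)[OF \<theta> int2])
  have m: "0 < m"
    using R tail_fps_pos[OF b_pos, of 1] b_sums suminf_pos[of "fps_nth (tail_fps 1 b)"]
    by (simp add: sums_iff)
  have "fps_nth (inverse (1 - \<beta>f)) \<longlonglongrightarrow> 1 / m"
    using renewal_theorem[OF b_pos tail_of_b_critical(2)[OF \<theta> int2]] R by (simp add: sums_iff)
  then have "fps_nth \<pi>f \<longlonglongrightarrow> 1 / m"
    unfolding \<pi>f_def by (rule mix_convolution_tendsto)
  then have "(\<lambda>n. S n / real n) \<longlonglongrightarrow> 1 / m"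
    unfolding S_def by (rule tendsto_cesaro)
  then have "(\<lambda>n. inverse (S n / real n)) \<longlonglongrightarrow> inverse (1 / m)"
    using m by (intro tendsto_inverse) simp_all
  then show ?thesis
    by (simp add: loss_prob_eq m_def)
qed

lemma loss_prob_overloaded:
  assumes \<theta>: "\<theta> < 1"
  shows "loss_prob A \<mu> \<longlonglongrightarrow> 1 - \<theta>"
proof -
  have S_mono: "S i \<le> S n" if "i \<le> n" for i n
    unfolding S_def using that \<pi>f_nonneg by (intro sum_mono2) auto
  \<comment> \<open>From \<open>(1 - X) * (1 - \<beta>f) * S = \<alpha>f\<close> one reads
    \<open>S n\<close> as a partial sum of \<open>a\<close> plus a convolution of \<open>b\<close>
    with \<open>S\<close>. Monotonicity of \<open>S\<close> then yields
    \<open>S n \<le> 1 + \<theta> * S n\<close>.\<close>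
  have S_bound: "S n \<le> 1 / (1 - \<theta>)" for n
  proof -
    have "(1 - fps_X) * ((1 - \<beta>f) * Abs_fps S) = \<alpha>f"
      using S_mult by (simp add: \<alpha>f_minus_X mult_ac)
    then have "((1 - \<beta>f) * Abs_fps S) $ n = (\<Sum>k\<le>n. a k)"
      using fps_nth_eq_partial_sum[of _ \<alpha>f n] by simp
    then have "S n = (\<Sum>k\<le>n. a k) + (\<Sum>i\<le>n. b i * S (n - i))"
      by (simp add: left_diff_distrib fps_mult_nth atLeast0AtMost)
    also have "(\<Sum>k\<le>n. a k) \<le> 1"
      using b_pos[of n] by (simp add: b_eq)
    also have "(\<Sum>i\<le>n. b i * S (n - i)) \<le> (\<Sum>i\<le>n. b i * S n)"
      using S_mono b_pos by (intro sum_mono mult_left_mono) (auto intro: less_imp_le)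
    also have "\<dots> = (\<Sum>i\<le>n. b i) * S n"
      by (simp add: sum_distrib_right)
    also have "\<dots> \<le> \<theta> * S n"
      using S_ge_1[of n] b_sums b_pos sum_le_suminf[of b "{..n}"]
      by (intro mult_right_mono) (auto simp: sums_iff intro: less_imp_le)
    finally show ?thesis
      using \<theta> by (simp add: field_simps)
  qed
  have "summable (fps_nth \<pi>f)"
  proof (rule summableI_nonneg_bounded[OF \<pi>f_nonneg])
    show "(\<Sum>k<n. \<pi>f $ k) \<le> 1 / (1 - \<theta>)" for n
      using S_bound[of n] \<pi>f_nonneg[of n] by (simp add: S_def lessThan_Suc_atMost[symmetric])
  qed
  then obtain L where L: "fps_nth \<pi>f sums L"
    by (auto simp: summable_def)
  \<comment> \<open>The Cauchy product evaluates \<open>\<pi>f * (1 - \<beta>f) = \<alpha>f\<close>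
    at the point \<open>1\<close>.\<close>
  have "(\<lambda>k. \<Sum>i\<le>k. b i * \<pi>f $ (k - i)) sums (\<theta> * L)"
    using Cauchy_product_sums[of b "fps_nth \<pi>f"] b_sums L b_pos \<pi>f_nonneg
    by (simp add: sums_iff less_imp_le abs_of_pos)
  from sums_diff[OF L this] have "(\<lambda>k. \<pi>f $ k - (\<beta>f * \<pi>f) $ k) sums (L - \<theta> * L)"
    by (simp add: fps_mult_nth atLeast0AtMost)
  moreover have "\<pi>f $ k - (\<beta>f * \<pi>f) $ k = a k" for k
    using arg_cong[OF \<pi>f_mult, of "\<lambda>f. f $ k"] by (simp add: right_diff_distrib mult.commute)
  ultimately have "L - \<theta> * L = 1"
    using mix_sums sums_unique2 by simp
  then have L_eq: "L * (1 - \<theta>) = 1"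
    by (simp add: algebra_simps)
  then have "L \<noteq> 0" by auto
  have "S \<longlonglongrightarrow> L"
    using L unfolding sums_def_le S_def .
  then have "(\<lambda>n. inverse (S n)) \<longlonglongrightarrow> inverse L"
    using \<open>L \<noteq> 0\<close> by (rule tendsto_inverse)
  moreover have "inverse L = 1 - \<theta>"
    using L_eq \<open>L \<noteq> 0\<close> by (simp add: field_simps)
  ultimately show ?thesis
    by (simp add: loss_prob_eq[abs_def] inverse_eq_divide)
qed

section \<open>The root \<open>\<sigma>\<close> in the stable case\<close>

lemma eval_\<beta>f_mono:
  assumes "0 \<le> z" "z < w" "w < 1"
  shows "eval_fps \<beta>f z < eval_fps \<beta>f w"
proof -
  have s: "(\<lambda>k. b k * z ^ k) sums eval_fps \<beta>f z" "(\<lambda>k. b k * w ^ k) sums eval_fps \<beta>f w"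
    using assms by (auto intro!: eval_\<beta>f_sums)
  from sums_diff[OF s(2,1)] have "(\<lambda>k. b k * w ^ k - b k * z ^ k) sums (eval_fps \<beta>f w - eval_fps \<beta>f z)" .
  moreover have "0 \<le> b k * w ^ k - b k * z ^ k" for k
    using assms b_pos[of k] by (auto intro!: mult_left_mono power_mono)
  moreover have "0 < b 1 * w ^ 1 - b 1 * z ^ 1"
    using assms b_pos[of 1] by simp
  ultimately have "0 < eval_fps \<beta>f w - eval_fps \<beta>f z"
    using suminf_pos2[of "\<lambda>k. b k * w ^ k - b k * z ^ k" 1] by (simp add: sums_iff)
  then show ?thesis by simp
qed

lemma laplace_fixed_point_diff:
  assumes "0 \<le> z" "z < 1"
  shows "laplace_stieltjes A (\<mu> - \<mu> * z) - z = (1 - z) * (1 - eval_fps \<beta>f z)"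
  using eval_\<beta>f[of z] eval_mix[of z] assms by (simp add: algebra_simps)

text \<open>By the factor \<open>1 - z\<close>, the fixed points in \<open>[0, 1)\<close> are the
  solutions of \<open>B(z) = 1\<close>. Since \<open>B(0) < 1\<close>,
  \<open>B(1) = \<theta> > 1\<close> and \<open>B\<close> is continuous and strictly increasing,
  there is exactly one; below it the fixed-point difference is positive.\<close>

lemma min_root_stable:
  assumes \<theta>: "1 < \<theta>"
  shows "0 < min_root A \<mu>" "min_root A \<mu> < 1" "eval_fps \<beta>f (min_root A \<mu>) = 1"
proof -
  \<comment> \<open>A finite partial sum of \<open>b\<close> already exceeds \<open>1\<close>. As a
    polynomial in \<open>z\<close> it still does so at some \<open>w = 1 - h n\<close>, which keeps
    the crossing strictly inside the disc.\<close>
  have "\<forall>\<^sub>F n in sequentially. 1 < (\<Sum>k<n. b k)"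
    using b_sums \<theta> unfolding sums_def by (rule order_tendstoD)
  then obtain N where N: "1 < (\<Sum>k<N. b k)"
    by (auto simp: eventually_sequentially)
  have "(\<lambda>n. \<Sum>k<N. b k * (1 - h n) ^ k) \<longlonglongrightarrow> (\<Sum>k<N. b k * (1 - 0) ^ k)"
    by (intro tendsto_intros h_tendsto)
  then have "\<forall>\<^sub>F n in sequentially. 1 < (\<Sum>k<N. b k * (1 - h n) ^ k)"
    using N by (intro order_tendstoD) auto
  then obtain n where n: "1 < (\<Sum>k<N. b k * (1 - h n) ^ k)"
    by (auto simp: eventually_sequentially)
  define w where "w = 1 - h n"
  have w: "0 < w" "w < 1"
    using h[of n] by (auto simp: w_def)
  have "(\<Sum>k<N. b k * w ^ k) \<le> eval_fps \<beta>f w"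
    using eval_\<beta>f_sums[of w] w b_pos sum_le_suminf[of "\<lambda>k. b k * w ^ k" "{..<N}"]
    by (simp add: sums_iff less_imp_le)
  then have w1: "1 \<le> eval_fps \<beta>f w"
    using n by (simp add: w_def)
  have "\<exists>z\<ge>0. z \<le> w \<and> eval_fps \<beta>f z = 1"
  proof (rule IVT')
    show "eval_fps \<beta>f 0 \<le> 1"
      using b_0 by (simp add: eval_fps_at_0)
    show "continuous_on {0..w} (eval_fps \<beta>f)"
    proof (rule continuous_on_subset[OF continuous_on_eval_fps])
      have "ereal \<bar>z\<bar> < fps_conv_radius \<beta>f" if "0 \<le> z" "z \<le> w" for z
        using fps_conv_radius_gt[of \<beta>f 1 z] b_le_1 that w by simp
      then show "{0..w} \<subseteq> eball 0 (fps_conv_radius \<beta>f)"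
        by (auto simp: in_eball_iff)
    qed
  qed (use w w1 in auto)
  then obtain z where z: "0 \<le> z" "z \<le> w" "eval_fps \<beta>f z = 1"
    by blast
  have "z \<noteq> 0"
    using z b_0 by (auto simp: eval_fps_at_0)
  have "min_root A \<mu> = z"
    unfolding min_root_def
  proof (rule Least_equality)
    show "0 \<le> z \<and> z = laplace_stieltjes A (\<mu> - \<mu> * z)"
      using laplace_fixed_point_diff[of z] z w by simp
    fix y assume y: "0 \<le> y \<and> y = laplace_stieltjes A (\<mu> - \<mu> * y)"
    show "z \<le> y"
    proof (rule ccontr)
      assume "\<not> z \<le> y"
      then have "eval_fps \<beta>f y < 1"
        using eval_\<beta>f_mono[of y z] y z w by simp
      then have "0 < (1 - y) * (1 - eval_fps \<beta>f y)"
        using \<open>\<not> z \<le> y\<close> z w by (intro mult_pos_pos) auto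
      then show False
        using laplace_fixed_point_diff[of y] y \<open>\<not> z \<le> y\<close> z w by simp
    qed
  qed
  then show "0 < min_root A \<mu>" "min_root A \<mu> < 1" "eval_fps \<beta>f (min_root A \<mu>) = 1"
    using z w \<open>z \<noteq> 0\<close> by auto
qed

text \<open>
  Besides \<open>\<sigma>\<close>, the only zero of \<open>F(z) - z\<close> in the closed unit disc is \<open>1\<close>. Dividing out \<open>\<sigma> - z\<close> leaves
  \<open>1 - C(z)\<close> with a probability generating function \<open>C\<close>, whose zero at \<open>1\<close> is controlled by the
  renewal theorem. The constant \<open>\<gamma>\<close> equals \<open>1 - C(\<sigma>)\<close>.
\<close>

lemma S_expansion:
  assumes \<theta>: "1 < \<theta>"
  defines "\<sigma> \<equiv> min_root A \<mu>"
  defines "\<gamma> \<equiv> 1 + \<mu> * deriv (laplace_stieltjes A) (\<mu> - \<mu> * \<sigma>)"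
  shows "\<gamma> \<noteq> 0" "(\<lambda>n. S n - 1 / (\<gamma> * \<sigma> ^ n)) \<longlonglongrightarrow> - (1 / (\<theta> - 1))"
proof -
  have \<sigma>: "0 < \<sigma>" "\<sigma> < 1" "eval_fps \<beta>f \<sigma> = 1"
    using min_root_stable[OF \<theta>] by (auto simp: \<sigma>_def)
  have \<sigma>_abs: "\<bar>\<sigma>\<bar> < 1"
    using \<sigma> by simp
  have eval_\<sigma>: "eval_fps \<alpha>f \<sigma> = \<sigma>"
    using eval_\<beta>f[OF \<sigma>_abs] \<sigma> by simp
  have a_sums: "(\<lambda>k. a k * \<sigma> ^ k) sums \<sigma>"
    using mix_powser_sums[of \<sigma>] eval_mix[of \<sigma>] eval_\<sigma> \<sigma> by simp
  have b_sums': "(\<lambda>k. b k * \<sigma> ^ k) sums 1"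
    using eval_\<beta>f_sums[OF \<sigma>_abs] \<sigma> by simp
  define c where "c = fps_nth (tail_fps \<sigma> a)"
  define R where "R = tail_fps \<sigma> b"
  let ?C = "Abs_fps c"
  have c_pos: "0 < c i" for i
    unfolding c_def using a_sums \<sigma> mix_pos by (intro tail_fps_pos) (auto simp: sums_iff)
  have C: "fps_const \<sigma> - \<alpha>f = (fps_const \<sigma> - fps_X) * ?C"
    using fps_const_minus_Abs_fps_eq_tail[of a \<sigma>] a_sums
    by (simp add: sums_iff c_def fps_nth_inverse)
  have \<alpha>_C: "\<alpha>f - fps_X = (fps_const \<sigma> - fps_X) * (1 - ?C)"
    using C by (simp add: right_diff_distrib) (metis add_diff_cancel_left' diff_add_cancel)
  have R: "1 - \<beta>f = (fps_const \<sigma> - fps_X) * R"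
    using fps_const_minus_Abs_fps_eq_tail[of b \<sigma>] b_sums'
    by (simp add: sums_iff R_def)
  have R_summable: "summable (fps_nth R)"
    unfolding R_def using b_sums b_pos \<sigma> by (intro summable_tail_fps) (auto simp: sums_iff intro: less_imp_le)
  \<comment> \<open>Both factorizations of \<open>\<alpha>f - X\<close> contain
    \<open>\<sigma> - X\<close>; cancelling it puts \<open>1 - ?C\<close> into the form required by
    the renewal theorem.\<close>
  have "(fps_const \<sigma> - fps_X) * (1 - ?C) = (fps_const \<sigma> - fps_X) * ((1 - fps_X) * R)"
    using \<alpha>_C \<alpha>f_minus_X R by (simp add: mult.left_commute)
  then have CR: "1 - ?C = (1 - fps_X) * R"
    using fps_const_minus_X_neq_0 by simp
  define m where "m = (\<Sum>i. R $ i)"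
  \<comment> \<open>This is \<open>1 - \<beta>f = (\<sigma> - X) * R\<close> evaluated at the point
    \<open>1\<close>, by summing the coefficients of both sides.\<close>
  have m: "(1 - \<sigma>) * m = \<theta> - 1"
  proof -
    have R_sums: "(\<lambda>n. R $ n) sums m"
      using R_summable by (simp add: m_def summable_sums)
    moreover have "fps_nth (fps_X * R) sums m"
      using sums_Suc[of "fps_nth (fps_X * R)" m] R_sums by simp
    ultimately have "(\<lambda>n. \<sigma> * R $ n - (fps_X * R) $ n) sums (\<sigma> * m - m)"
      by (intro sums_diff sums_mult)
    moreover have "(\<lambda>n. \<sigma> * R $ n - (fps_X * R) $ n) = (\<lambda>n. (if n = 0 then 1 else 0) - b n)"
      using arg_cong[OF R, of fps_nth] by (simp add: fun_eq_iff left_diff_distrib)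
    moreover have "(\<lambda>n. (if n = 0 then 1 else 0) - b n) sums (1 - \<theta>)"
      by (intro sums_diff b_sums sums_single[of 0 "\<lambda>_. 1 :: real", simplified])
    ultimately have "\<sigma> * m - m = 1 - \<theta>"
      using sums_unique2 by metis
    then show ?thesis by (simp add: algebra_simps)
  qed
  have m_pos: "0 < m"
    using m \<theta> \<sigma> by (metis diff_gt_0_iff_gt zero_less_mult_pos)
  define V where "V = inverse (1 - ?C)"
  have "c 0 < 1"
  proof -
    have "1 - c 0 = R $ 0"
      using arg_cong[OF CR, of "\<lambda>f. f $ 0"] by simp
    moreover have "0 < R $ 0"
      unfolding R_def using b_sums' \<sigma> b_pos by (intro tail_fps_pos) (auto simp: sums_iff)
    ultimately show ?thesis by simp
  qed
  then have V: "(1 - ?C) * V = 1"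
    unfolding V_def by (rule fps_one_minus_inverse)
  have V_lim: "fps_nth V \<longlonglongrightarrow> 1 / m"
    unfolding V_def m_def by (rule renewal_theorem[OF c_pos CR R_summable])
  define W where "W = \<alpha>f * V"
  have W_lim: "fps_nth W \<longlonglongrightarrow> 1 / m"
    unfolding W_def by (rule mix_convolution_tendsto[OF V_lim])
  have SW: "(fps_const \<sigma> - fps_X) * Abs_fps S = W"
  proof -
    have "W = ((\<alpha>f - fps_X) * Abs_fps S) * V"
      by (simp add: S_mult W_def)
    also have "\<dots> = ((fps_const \<sigma> - fps_X) * Abs_fps S) * ((1 - ?C) * V)"
      by (simp add: \<alpha>_C mult_ac)
    finally show ?thesis by (simp add: V)
  qed

  \<comment> \<open>Bounded coefficients make all three series convergent at
    \<open>\<sigma>\<close>, where the identities between them are now evaluated.\<close>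
  obtain Mv Mw Mc where Mv: "\<And>n. \<bar>V $ n\<bar> \<le> Mv" and Mw: "\<And>n. \<bar>W $ n\<bar> \<le> Mw" and Mc: "\<And>n. \<bar>?C $ n\<bar> \<le> Mc"
  proof -
    have "summable c"
      unfolding c_def using mix_sums mix_pos \<sigma>
      by (intro summable_tail_fps) (auto simp: sums_iff intro: less_imp_le)
    then show ?thesis
      using that convergent_abs_bound[OF convergentI[OF V_lim]]
        convergent_abs_bound[OF convergentI[OF W_lim]] summable_abs_bound[of c]
      by (metis fps_nth_Abs_fps)
  qed
  have rad_\<alpha>: "ereal (norm z) < fps_conv_radius \<alpha>f" if "\<bar>z\<bar> < 1" for z :: real
    using fps_conv_radius_gt[of \<alpha>f 1 z] mix_le_1 that by simp
  have rad_V: "ereal (norm \<sigma>) < fps_conv_radius V"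
    by (rule fps_conv_radius_gt[OF Mv \<sigma>_abs])
  have rad_W: "ereal (norm \<sigma>) < fps_conv_radius W"
    by (rule fps_conv_radius_gt[OF Mw \<sigma>_abs])
  have rad_C: "ereal (norm \<sigma>) < fps_conv_radius ?C"
    by (rule fps_conv_radius_gt[OF Mc \<sigma>_abs])
  have rad_1C: "ereal (norm \<sigma>) < fps_conv_radius (1 - ?C)"
    using rad_C by (intro less_le_trans[OF _ fps_conv_radius_diff]) simp
  have VC: "(1 - eval_fps ?C \<sigma>) * eval_fps V \<sigma> = 1"
  proof -
    have "eval_fps ((1 - ?C) * V) \<sigma> = 1"
      by (simp add: V)
    then show ?thesis
      using rad_V rad_C rad_1C by (simp add: eval_fps_mult eval_fps_diff)
  qed
  have eval_W: "eval_fps W \<sigma> = \<sigma> * eval_fps V \<sigma>"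
    unfolding W_def using rad_V rad_\<alpha>[OF \<sigma>_abs] by (simp add: eval_fps_mult eval_\<sigma>)

  have \<gamma>: "\<gamma> = 1 - eval_fps ?C \<sigma>"
  proof -
    define s0 where "s0 = \<mu> - \<mu> * \<sigma>"
    \<comment> \<open>With \<open>z = 1 - s / \<mu>\<close> the factorization through
      \<open>?C\<close> reads \<open>\<alpha>(s) = \<sigma> + (z - \<sigma>) * C(z)\<close>. The
      factor \<open>z - \<sigma>\<close> vanishes at \<open>s0\<close>, so the derivative there is
      just \<open>- C(\<sigma>) / \<mu>\<close>.\<close>
    define F where "F s = \<sigma> + (s - s0) * (- 1 / \<mu>) * eval_fps ?C (1 - s / \<mu>)" for s
    have \<mu>: "0 < \<mu>" by (rule service.rate_pos)
    have s0: "0 < s0" "s0 < \<mu>" "1 - s0 / \<mu> = \<sigma>"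
      using \<mu> \<sigma> by (auto simp: s0_def field_simps)
    have "((\<lambda>s. eval_fps ?C (1 - s / \<mu>)) has_real_derivative
        eval_fps (fps_deriv ?C) (1 - s0 / \<mu>) * (- 1 / \<mu>)) (at s0)"
    proof (rule DERIV_chain2[where f = "eval_fps ?C" and g = "\<lambda>s. 1 - s / \<mu>"])
      show "(eval_fps ?C has_real_derivative eval_fps (fps_deriv ?C) (1 - s0 / \<mu>)) (at (1 - s0 / \<mu>))"
        using rad_C s0 by (intro has_field_derivative_eval_fps) simp
      show "((\<lambda>s. 1 - s / \<mu>) has_real_derivative - 1 / \<mu>) (at s0)"
        using \<mu> by (auto intro!: derivative_eq_intros)
    qed
    then have dF: "(F has_real_derivative (- 1 / \<mu>) * eval_fps ?C \<sigma>) (at s0)"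
      unfolding F_def using s0(3) \<mu> by (auto intro!: derivative_eq_intros)
    have F_eq: "F s = laplace_stieltjes A s" if "s \<in> {0<..<\<mu>}" for s
    proof -
      define z where "z = 1 - s / \<mu>"
      have z: "0 \<le> z" "z < 1" "\<bar>z\<bar> < 1" "\<mu> - \<mu> * z = s"
        using that \<mu> by (auto simp: z_def field_simps)
      have "\<sigma> - eval_fps \<alpha>f z = (\<sigma> - z) * eval_fps ?C z"
        by (rule eval_fps_tail[OF C _ Mc z(3), of 1]) (simp add: mix_le_1)
      moreover have "(s - s0) * (- 1 / \<mu>) = z - \<sigma>"
        using \<mu> by (simp add: z_def s0_def field_simps)
      ultimately have "F s = eval_fps \<alpha>f z"
        by (simp add: F_def z_def[symmetric] algebra_simps)
      then show ?thesis
        using eval_mix[OF z(1,2)] z(4) by simp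
    qed
    have "(laplace_stieltjes A has_real_derivative (- 1 / \<mu>) * eval_fps ?C \<sigma>) (at s0)"
      by (rule has_field_derivative_transform_within_open[OF dF, of "{0<..<\<mu>}"])
        (use s0 in simp_all, rule F_eq, simp)
    then show ?thesis
      using \<mu> by (simp add: DERIV_imp_deriv \<gamma>_def s0_def)
  qed
  show "\<gamma> \<noteq> 0"
    using VC \<gamma> by auto
  then have eval_V: "eval_fps V \<sigma> = 1 / \<gamma>"
    using VC by (simp add: \<gamma>[symmetric] nonzero_eq_divide_eq mult.commute)

  \<comment> \<open>This splits off the pole of \<open>S = W / (\<sigma> - X)\<close> at
    \<open>\<sigma>\<close>: \<open>S + T = W(\<sigma>) / (\<sigma> - X)\<close> has the
    coefficients \<open>W(\<sigma>) / \<sigma> ^ Suc n\<close>, equal to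
    \<open>1 / (\<gamma> * \<sigma> ^ n)\<close> because
    \<open>W(\<sigma>) = \<sigma> / \<gamma>\<close>. The remainder \<open>- T\<close> converges
    since the coefficients of \<open>W\<close> do.\<close>
  define T where "T = tail_fps \<sigma> (fps_nth W)"
  have "fps_const (eval_fps W \<sigma>) - W = (fps_const \<sigma> - fps_X) * T"
    using fps_const_minus_Abs_fps_eq_tail[of "fps_nth W" \<sigma>] summable_fps[OF rad_W]
    by (simp add: eval_fps_def T_def fps_nth_inverse)
  then have "(fps_const \<sigma> - fps_X) * (Abs_fps S + T) = fps_const (eval_fps W \<sigma>)"
    unfolding distrib_left SW by (metis add.commute diff_add_cancel)
  then have "(Abs_fps S + T) $ n = eval_fps W \<sigma> / \<sigma> ^ Suc n" for n
    using \<sigma> by (intro fps_nth_div_const_minus_X) auto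
  then have S_eq: "S n - 1 / (\<gamma> * \<sigma> ^ n) = - (T $ n)" for n
    using \<sigma> by (simp add: eval_W eval_V algebra_simps)
  have "fps_nth T \<longlonglongrightarrow> (1 / m) / (1 - \<sigma>)"
    unfolding T_def using W_lim \<sigma> by (intro tail_fps_tendsto) auto
  moreover have "(1 / m) / (1 - \<sigma>) = 1 / (\<theta> - 1)"
    by (simp add: m[symmetric] mult.commute)
  ultimately show "(\<lambda>n. S n - 1 / (\<gamma> * \<sigma> ^ n)) \<longlonglongrightarrow> - (1 / (\<theta> - 1))"
    unfolding S_eq by (simp add: tendsto_minus)
qed

end

text \<open>With \<open>u n = 1 - d * \<gamma> * \<sigma> ^ n\<close> and the vanishing error
  \<open>e n\<close>, \<open>s n\<close> is \<open>v n / (\<gamma> * \<sigma> ^ n)\<close> for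
  \<open>v n = u n + \<gamma> * \<sigma> ^ n * e n\<close>. The difference of the reciprocals is
  \<open>- \<gamma>\<^sup>2 * \<sigma> ^ (2 * n) * e n / (u n * v n)\<close>, where \<open>u\<close>
  and \<open>v\<close> tend to \<open>1\<close>.\<close>

lemma inverse_expansion_smallo:
  fixes s :: "nat \<Rightarrow> real"
  assumes \<sigma>: "0 < \<sigma>" "\<sigma> < 1" and \<gamma>: "\<gamma> \<noteq> 0" and s: "(\<lambda>n. s n - 1 / (\<gamma> * \<sigma> ^ n)) \<longlonglongrightarrow> - d"
  shows "(\<lambda>n. 1 / s n - \<gamma> * \<sigma> ^ n / (1 - d * \<gamma> * \<sigma> ^ n)) \<in> o(\<lambda>n. \<sigma> ^ (2 * n))"
proof (rule smalloI_tendsto)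
  define e where "e n = s n - 1 / (\<gamma> * \<sigma> ^ n) + d" for n
  have e: "e \<longlonglongrightarrow> 0"
    unfolding e_def[abs_def] using tendsto_add[OF s tendsto_const[of d]] by simp
  have pow: "(\<lambda>n. \<sigma> ^ n) \<longlonglongrightarrow> 0"
    using \<sigma> by (intro LIMSEQ_power_zero) auto
  define u where "u n = 1 - d * \<gamma> * \<sigma> ^ n" for n
  define v where "v n = u n + \<gamma> * \<sigma> ^ n * e n" for n
  have "u \<longlonglongrightarrow> 1 - d * \<gamma> * 0"
    unfolding u_def[abs_def] by (intro tendsto_intros pow)
  then have u: "u \<longlonglongrightarrow> 1" by simp
  have "v \<longlonglongrightarrow> 1 + \<gamma> * 0 * 0"
    unfolding v_def[abs_def] by (intro tendsto_intros pow u e)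
  then have v: "v \<longlonglongrightarrow> 1" by simp
  have s_eq: "s n = v n / (\<gamma> * \<sigma> ^ n)" for n
    using \<sigma> \<gamma> by (simp add: v_def u_def e_def field_simps)
  have "(\<lambda>n. - (\<gamma>\<^sup>2 * e n) / (u n * v n)) \<longlonglongrightarrow> - (\<gamma>\<^sup>2 * 0) / (1 * 1)"
    by (intro tendsto_intros e u v) auto
  then have lim: "(\<lambda>n. - (\<gamma>\<^sup>2 * e n) / (u n * v n)) \<longlonglongrightarrow> 0" by simp
  \<comment> \<open>The denominators are known to be nonzero only eventually, so the identity for
    the quotient is an eventual one.\<close>
  have "\<forall>\<^sub>F n in sequentially. 0 < u n" "\<forall>\<^sub>F n in sequentially. 0 < v n"
    using u v by (auto intro: order_tendstoD)
  then have "\<forall>\<^sub>F n in sequentially. - (\<gamma>\<^sup>2 * e n) / (u n * v n)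
      = (1 / s n - \<gamma> * \<sigma> ^ n / (1 - d * \<gamma> * \<sigma> ^ n)) / \<sigma> ^ (2 * n)"
  proof eventually_elim
    case (elim n)
    have "1 / s n - \<gamma> * \<sigma> ^ n / u n = \<gamma> * \<sigma> ^ n * (u n - v n) / (u n * v n)"
      using elim \<sigma> \<gamma> by (simp add: s_eq field_simps)
    also have "\<dots> = - (\<gamma>\<^sup>2 * e n) / (u n * v n) * \<sigma> ^ (2 * n)"
      by (simp add: v_def power2_eq_square power_mult power_mult_distrib mult_2 power_add)
    finally show ?case
      using \<sigma> by (simp add: u_def)
  qed
  from Lim_transform_eventually[OF lim this]
  show "(\<lambda>n. (1 / s n - \<gamma> * \<sigma> ^ n / (1 - d * \<gamma> * \<sigma> ^ n)) / \<sigma> ^ (2 * n)) \<longlonglongrightarrow> 0" .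
qed (use \<sigma> in auto)

theorem theorem3p1:
  fixes A :: "real measure" and lam \<mu> \<rho> \<sigma> :: real
    and \<alpha> :: "real \<Rightarrow> real" and p :: "nat \<Rightarrow> real"
  assumes A: "real_distribution A" "AE x in A. 0 \<le> x"
    and mean: "0 < lam" "integrable A (\<lambda>x. x)" "(LINT x|A. x) = 1 / lam"
    and \<mu>: "0 < \<mu>"
    and \<rho>: "\<rho> = lam / \<mu>"
    and \<alpha>: "\<alpha> = laplace_stieltjes A"
    and \<sigma>: "\<sigma> = min_root A \<mu>"
    and p: "p = loss_prob A \<mu>"
  shows
    "(\<rho> < 1 \<longrightarrow>
        0 < \<sigma> \<and> \<sigma> < 1 \<and>
        (\<lambda>n. p n -
              (1 - \<rho>) * (1 + \<mu> * deriv \<alpha> (\<mu> - \<mu> * \<sigma>)) * \<sigma> ^ n /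
              (1 - \<rho> - \<rho> * (1 + \<mu> * deriv \<alpha> (\<mu> - \<mu> * \<sigma>)) * \<sigma> ^ n))
          \<in> o(\<lambda>n. \<sigma> ^ (2 * n))) \<and>
     (\<rho> = 1 \<and> integrable A (\<lambda>x. x ^ 2) \<longrightarrow>
        (\<lambda>n. real n * p n) \<longlonglongrightarrow> rho_moment A \<mu> 2 / 2) \<and>
     (\<rho> > 1 \<longrightarrow> p \<longlonglongrightarrow> (\<rho> - 1) / \<rho>)"
proof -
  interpret real_distribution A by (rule A)
  interpret gi_m_1_mean A \<mu>
    by unfold_locales (use A mean \<mu> in auto)
  have \<rho>_pos: "0 < \<rho>"
    using mean \<mu> by (simp add: \<rho>)
  have \<theta>: "\<theta> = 1 / \<rho>"
    using mean by (simp add: \<rho>)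
  show ?thesis
  proof (intro conjI impI)
    assume "\<rho> < 1"
    then have \<theta>1: "1 < \<theta>"
      using \<rho>_pos by (simp add: \<theta>)
    show \<sigma>01: "0 < \<sigma>" "\<sigma> < 1"
      using min_root_stable[OF \<theta>1] by (auto simp: \<sigma>)
    define \<gamma> where "\<gamma> = 1 + \<mu> * deriv \<alpha> (\<mu> - \<mu> * \<sigma>)"
    \<comment> \<open>This is the constant \<open>1 / (\<theta> - 1)\<close> of the expansion of
      \<open>S\<close>, rewritten with \<open>\<theta> = 1 / \<rho>\<close>; extending the fraction
      by \<open>1 - \<rho>\<close> then gives the stated form.\<close>
    define d where "d = \<rho> / (1 - \<rho>)"
    have "1 / (\<theta> - 1) = d"
      using \<rho>_pos \<open>\<rho> < 1\<close> by (simp add: \<theta> d_def field_simps)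
    then have "(\<lambda>n. 1 / S n - \<gamma> * \<sigma> ^ n / (1 - d * \<gamma> * \<sigma> ^ n)) \<in> o(\<lambda>n. \<sigma> ^ (2 * n))"
      using S_expansion[OF \<theta>1] \<sigma>01
      by (intro inverse_expansion_smallo) (simp_all add: \<gamma>_def \<alpha> \<sigma>)
    moreover have "\<gamma> * \<sigma> ^ n / (1 - d * \<gamma> * \<sigma> ^ n)
        = (1 - \<rho>) * \<gamma> * \<sigma> ^ n / (1 - \<rho> - \<rho> * \<gamma> * \<sigma> ^ n)" for n
    proof -
      have "1 - \<rho> - \<rho> * \<gamma> * \<sigma> ^ n = (1 - \<rho>) * (1 - d * \<gamma> * \<sigma> ^ n)"
        using \<open>\<rho> < 1\<close> by (simp add: d_def field_simps)
      then show ?thesis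
        using \<open>\<rho> < 1\<close> by (simp add: mult.assoc)
    qed
    ultimately show "(\<lambda>n. p n - (1 - \<rho>) * (1 + \<mu> * deriv \<alpha> (\<mu> - \<mu> * \<sigma>)) * \<sigma> ^ n /
        (1 - \<rho> - \<rho> * (1 + \<mu> * deriv \<alpha> (\<mu> - \<mu> * \<sigma>)) * \<sigma> ^ n)) \<in> o(\<lambda>n. \<sigma> ^ (2 * n))"
      by (simp add: p loss_prob_eq \<gamma>_def)
  next
    assume "\<rho> = 1 \<and> integrable A (\<lambda>x. x ^ 2)"
    then show "(\<lambda>n. real n * p n) \<longlonglongrightarrow> rho_moment A \<mu> 2 / 2"
      unfolding p by (intro loss_prob_critical) (auto simp: \<theta>)
  next
    assume "\<rho> > 1"
    then have "\<theta> < 1"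
      by (simp add: \<theta>)
    from loss_prob_overloaded[OF this] show "p \<longlonglongrightarrow> (\<rho> - 1) / \<rho>"
      using \<rho>_pos by (simp add: p \<theta> diff_divide_distrib)
  qed
qed

end
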